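(* Let $R$ be a commutative ring, $H$ a Hopf algebra over $R$, and $A$ a right $H$-comodule algebra with $B=A^{co\,H}$, such that the canonical map $\mathrm{can}_H:A\otimes_BA\to A\otimes H$, $a\otimes b\mapsto ab_{(0)}\otimes b_{(1)}$, is surjective. Assume that there exists a map $\psi:\mathrm{Sub}_{Alg}(A/B)\to\mathrm{Quot}_{gen}(H)$ which forms a Galois connection with $\phi:\mathrm{Quot}_{gen}(H)\to\mathrm{Sub}_{Alg}(A/B)$, $\phi(Q)=A^{co\,Q}$, and assume that the unit map $1_A:R\to A$ is a pure monomorphism of $R$-modules. Then $Q\in\mathrm{Quot}_{gen}(H)$ is a closed element of this Galois connection if $A/A^{co\,Q}$ is $Q$-Galois.
   Context: Algebras are associative and unital; unadorned $\otimes$ is over $R$. A right $H$-comodule algebra is an algebra $A$ with a counital coassociative coaction $\delta_A:A\to A\otimes H$, $a\mapsto a_{(0)}\otimes a_{(1)}$, that is an algebra homomorphism; $A^{co\,H}=\{a:\delta_A(a)=a\otimes1_H\}$. $\mathrm{Sub}_{Alg}(A/B)$ is the poset (under inclusion) of subalgebras $S$ with $B\subseteq S\subseteq A$. $\mathrm{Quot}_{gen}(H)$ is the set of quotients $H/I$ by right ideal coideals $I$, ordered by $H/I\succcurlyeq H/J\Leftrightarrow I\subseteq J$. For $Q$ in it with projection $\pi:H\to Q$, $A^{co\,Q}=\{a\in A:a_{(0)}\otimes\pi(a_{(1)})=a\otimes\pi(1_H)\}$. $A/A^{co\,Q}$ is $Q$-Galois if $\mathrm{can}_Q:A\otimes_{A^{co\,Q}}A\to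 A\otimes Q$, $a\otimes b\mapsto ab_{(0)}\otimes\pi(b_{(1)})$, is bijective. A Galois connection is a pair of order-reversing maps $\phi,\psi$ with $S\subseteq\phi\psi(S)$ and $Q\preccurlyeq\psi\phi(Q)$ for all $S,Q$; $Q$ is closed if $\psi\phi(Q)=Q$. *)

theory Defs
  imports "HOL-Algebra.Free_Abelian_Groups" "HOL-Algebra.Module" "HOL-Algebra.Subrings"
begin

section \<open>Tensor products\<close>

text \<open>
  For a right \<open>S\<close>-module \<open>M\<close> (action \<open>ra\<close>) and a left \<open>S\<close>-module \<open>N\<close> (action \<open>la\<close>), the abelian
  group \<open>M \<otimes>\<^sub>S N\<close> is the free abelian group on \<open>carrier M \<times> carrier N\<close> modulo the subgroup generated
  by the biadditivity and balancing relations.  Following the library's treatment of quotients, it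
  is a multiplicatively written group of cosets.
\<close>

definition tensor_relations ::
    "'s set \<Rightarrow> ('m \<Rightarrow> 's \<Rightarrow> 'm) \<Rightarrow> ('s \<Rightarrow> 'n \<Rightarrow> 'n) \<Rightarrow>
     ('m, 'x) ring_scheme \<Rightarrow> ('n, 'y) ring_scheme \<Rightarrow> ('m \<times> 'n \<Rightarrow>\<^sub>0 int) set"
  where "tensor_relations S ra la M N =
    {frag_of (m \<oplus>\<^bsub>M\<^esub> m', n) - frag_of (m, n) - frag_of (m', n) | m m' n.
       m \<in> carrier M \<and> m' \<in> carrier M \<and> n \<in> carrier N} \<union>
    {frag_of (m, n \<oplus>\<^bsub>N\<^esub> n') - frag_of (m, n) - frag_of (m, n') | m n n'.
       m \<in> carrier M \<and> n \<in> carrier N \<and> n' \<in> carrier N} \<union>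
    {frag_of (ra m s, n) - frag_of (m, la s n) | m s n.
       m \<in> carrier M \<and> s \<in> S \<and> n \<in> carrier N}"

definition tensor_kernel ::
    "'s set \<Rightarrow> ('m \<Rightarrow> 's \<Rightarrow> 'm) \<Rightarrow> ('s \<Rightarrow> 'n \<Rightarrow> 'n) \<Rightarrow>
     ('m, 'x) ring_scheme \<Rightarrow> ('n, 'y) ring_scheme \<Rightarrow> ('m \<times> 'n \<Rightarrow>\<^sub>0 int) set"
  where "tensor_kernel S ra la M N =
    generate (free_Abelian_group (carrier M \<times> carrier N)) (tensor_relations S ra la M N)"

definition tensor_group ::
    "'s set \<Rightarrow> ('m \<Rightarrow> 's \<Rightarrow> 'm) \<Rightarrow> ('s \<Rightarrow> 'n \<Rightarrow> 'n) \<Rightarrow>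
     ('m, 'x) ring_scheme \<Rightarrow> ('n, 'y) ring_scheme \<Rightarrow> ('m \<times> 'n \<Rightarrow>\<^sub>0 int) set monoid"
  where "tensor_group S ra la M N =
    free_Abelian_group (carrier M \<times> carrier N) Mod tensor_kernel S ra la M N"

definition tensor_elem ::
    "'s set \<Rightarrow> ('m \<Rightarrow> 's \<Rightarrow> 'm) \<Rightarrow> ('s \<Rightarrow> 'n \<Rightarrow> 'n) \<Rightarrow>
     ('m, 'x) ring_scheme \<Rightarrow> ('n, 'y) ring_scheme \<Rightarrow> 'm \<Rightarrow> 'n \<Rightarrow> ('m \<times> 'n \<Rightarrow>\<^sub>0 int) set"
  where "tensor_elem S ra la M N m n =
    tensor_kernel S ra la M N #>\<^bsub>free_Abelian_group (carrier M \<times> carrier N)\<^esub> frag_of (m, n)"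

text \<open>
  \<open>tensor_lift G f\<close> is the homomorphism from a tensor product to the abelian group \<open>G\<close>
  (written multiplicatively) with \<open>m \<otimes> n \<mapsto> f (m, n)\<close>, for \<open>f\<close> biadditive and balanced;
  see \<open>tensor_lift_universal\<close> below.  It evaluates the extension of \<open>f\<close> to the free abelian group on any
  representative of a coset, so neither the factors nor the scalars need to be mentioned.
\<close>

definition free_extend :: "('g, 'z) monoid_scheme \<Rightarrow> ('p \<Rightarrow> 'g) \<Rightarrow> ('p \<Rightarrow>\<^sub>0 int) \<Rightarrow> 'g"
  where "free_extend G f c =
    finprod G (\<lambda>p. f p [^]\<^bsub>G\<^esub> poly_mapping.lookup c p) (Poly_Mapping.keys c)"

definition tensor_lift :: "('g, 'z) monoid_scheme \<Rightarrow> ('p \<Rightarrow> 'g) \<Rightarrow> ('p \<Rightarrow>\<^sub>0 int) set \<Rightarrow> 'g"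
  where "tensor_lift G f X = the_elem (free_extend G f ` X)"

definition balanced_map ::
    "'s set \<Rightarrow> ('m \<Rightarrow> 's \<Rightarrow> 'm) \<Rightarrow> ('s \<Rightarrow> 'n \<Rightarrow> 'n) \<Rightarrow>
     ('m, 'x) ring_scheme \<Rightarrow> ('n, 'y) ring_scheme \<Rightarrow> ('g, 'z) monoid_scheme \<Rightarrow>
     ('m \<times> 'n \<Rightarrow> 'g) \<Rightarrow> bool"
  where "balanced_map S ra la M N G f \<longleftrightarrow>
    f \<in> carrier M \<times> carrier N \<rightarrow> carrier G \<and>
    (\<forall>m\<in>carrier M. \<forall>m'\<in>carrier M. \<forall>n\<in>carrier N.
       f (m \<oplus>\<^bsub>M\<^esub> m', n) = f (m, n) \<otimes>\<^bsub>G\<^esub> f (m', n)) \<and>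
    (\<forall>m\<in>carrier M. \<forall>n\<in>carrier N. \<forall>n'\<in>carrier N.
       f (m, n \<oplus>\<^bsub>N\<^esub> n') = f (m, n) \<otimes>\<^bsub>G\<^esub> f (m, n')) \<and>
    (\<forall>m\<in>carrier M. \<forall>s\<in>S. \<forall>n\<in>carrier N. f (ra m s, n) = f (m, la s n))"

lemma free_extend_hom:
  assumes "comm_group G" and f: "f \<in> P \<rightarrow> carrier G"
  shows "free_extend G f \<in> hom (free_Abelian_group P) G"
    and "p \<in> P \<Longrightarrow> free_extend G f (frag_of p) = f p"
proof -
  interpret comm_group G by fact
  have eq: "free_extend G f c = gfinprod G (\<lambda>p. f p [^]\<^bsub>G\<^esub> poly_mapping.lookup c p) P"
    if c: "Poly_Mapping.keys c \<subseteq> P" for c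
  proof -
    have "free_extend G f c =
        gfinprod G (\<lambda>p. f p [^]\<^bsub>G\<^esub> poly_mapping.lookup c p) (Poly_Mapping.keys c)"
      unfolding free_extend_def using c f by (subst gfinprod_eq_finprod) auto
    also have "\<dots> = gfinprod G (\<lambda>p. f p [^]\<^bsub>G\<^esub> poly_mapping.lookup c p) P"
      using c f by (intro gfinprod_mono_neutral_cong_left) (auto simp: in_keys_iff)
    finally show ?thesis .
  qed
  have fin: "finite {x \<in> P. f x [^]\<^bsub>G\<^esub> poly_mapping.lookup u x \<noteq> \<one>\<^bsub>G\<^esub>}" for u :: "_ \<Rightarrow>\<^sub>0 int"
    by (rule finite_subset [OF _ finite_keys [of u]]) (auto simp: in_keys_iff)
  show "free_extend G f \<in> hom (free_Abelian_group P) G"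
  proof (rule homI)
    fix c d
    assume cd: "c \<in> carrier (free_Abelian_group P)" "d \<in> carrier (free_Abelian_group P)"
    then have "Poly_Mapping.keys (c + d) \<subseteq> P"
      using keys_add [of c d] by auto
    with cd show "free_extend G f (c \<otimes>\<^bsub>free_Abelian_group P\<^esub> d) =
        free_extend G f c \<otimes>\<^bsub>G\<^esub> free_extend G f d"
      using f by (simp add: eq Pi_iff fin gfinprod_distrib Poly_Mapping.lookup_add int_pow_mult
          cong: gfinprod_cong)
  next
    fix c
    assume "c \<in> carrier (free_Abelian_group P)"
    then show "free_extend G f c \<in> carrier G"
      unfolding free_extend_def using f by (intro finprod_closed) auto
  qed
  show "free_extend G f (frag_of p) = f p" if "p \<in> P"
    using that f by (auto simp: free_extend_def Pi_iff finprod_singleton)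
qed

lemma tensor_lift_universal:
  assumes G: "comm_group G" and f: "balanced_map S ra la M N G f"
    and ra: "\<And>m s. m \<in> carrier M \<Longrightarrow> s \<in> S \<Longrightarrow> ra m s \<in> carrier M"
    and la: "\<And>n s. n \<in> carrier N \<Longrightarrow> s \<in> S \<Longrightarrow> la s n \<in> carrier N"
    and M: "abelian_group M" and N: "abelian_group N"
  shows "tensor_lift G f \<in> hom (tensor_group S ra la M N) G"
    and "m \<in> carrier M \<Longrightarrow> n \<in> carrier N \<Longrightarrow>
      tensor_lift G f (tensor_elem S ra la M N m n) = f (m, n)"
proof -
  let ?F = "free_Abelian_group (carrier M \<times> carrier N)"
  let ?K = "tensor_kernel S ra la M N"
  interpret G: comm_group G by (fact G)
  interpret M: abelian_group M by (fact M)
  interpret N: abelian_group N by (fact N)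
  interpret F: comm_group ?F by (rule abelian_free_Abelian_group)
  have fP: "f \<in> carrier M \<times> carrier N \<rightarrow> carrier G"
    using f by (simp add: balanced_map_def)
  note ext = free_extend_hom [OF G fP]
  interpret h: group_hom ?F G "free_extend G f"
    using ext(1) by unfold_locales
  have sub: "tensor_relations S ra la M N \<subseteq> carrier ?F"
    unfolding tensor_relations_def
    by (auto simp: ra la subset_iff dest!: subsetD [OF keys_diff])
  have K: "subgroup ?K ?F"
    unfolding tensor_kernel_def by (rule F.generate_is_subgroup [OF sub])
  have diff: "free_extend G f (x - y) = free_extend G f x \<otimes>\<^bsub>G\<^esub> inv\<^bsub>G\<^esub> free_extend G f y"
    if "x \<in> carrier ?F" "y \<in> carrier ?F" for x y
    using h.hom_mult [of x "inv\<^bsub>?F\<^esub> y"] h.hom_inv [of y] that by simp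
  have clos: "x - y \<in> carrier ?F" if "x \<in> carrier ?F" "y \<in> carrier ?F" for x y
    using that keys_diff [of x y] by auto
  have fc: "f (m, n) \<in> carrier G" if "m \<in> carrier M" "n \<in> carrier N" for m n
    using fP that by auto
  have cancel: "(a \<otimes>\<^bsub>G\<^esub> b) \<otimes>\<^bsub>G\<^esub> inv\<^bsub>G\<^esub> a \<otimes>\<^bsub>G\<^esub> inv\<^bsub>G\<^esub> b = \<one>\<^bsub>G\<^esub>"
    if "a \<in> carrier G" "b \<in> carrier G" for a b
    using that by (metis G.inv_closed G.inv_mult G.m_assoc G.m_closed G.r_inv)
  have rel: "free_extend G f x = \<one>\<^bsub>G\<^esub>" if "x \<in> tensor_relations S ra la M N" for x
    using that f unfolding tensor_relations_def balanced_map_def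
    by (auto simp: diff clos ext(2) ra la fc cancel simp del: carrier_free_Abelian_group_iff)
  have ker: "?K \<subseteq> kernel ?F G (free_extend G f)"
    unfolding tensor_kernel_def
    by (rule F.generate_subgroup_incl [OF _ h.subgroup_kernel])
       (use rel sub in \<open>auto simp: kernel_def simp del: carrier_free_Abelian_group_iff\<close>)
  have val: "tensor_lift G f (?K #>\<^bsub>?F\<^esub> x) = free_extend G f x" if x: "x \<in> carrier ?F" for x
  proof -
    have "free_extend G f ` (?K #>\<^bsub>?F\<^esub> x) = {free_extend G f x}"
    proof (intro equalityI subsetI)
      fix y assume "y \<in> free_extend G f ` (?K #>\<^bsub>?F\<^esub> x)"
      then obtain k where k: "k \<in> ?K" "y = free_extend G f (k \<otimes>\<^bsub>?F\<^esub> x)"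
        by (auto simp: r_coset_def)
      then have kc: "k \<in> carrier ?F" "free_extend G f k = \<one>\<^bsub>G\<^esub>"
        using ker by (auto simp: kernel_def)
      then have "y = free_extend G f x"
        unfolding k(2) using h.hom_mult [OF kc(1) x] h.hom_closed [OF x] by simp
      then show "y \<in> {free_extend G f x}" by simp
    next
      fix y assume "y \<in> {free_extend G f x}"
      then show "y \<in> free_extend G f ` (?K #>\<^bsub>?F\<^esub> x)"
        using F.rcos_self [OF x K] by auto
    qed
    then show ?thesis by (simp add: tensor_lift_def)
  qed
  have nrm: "?K \<lhd> ?F"
    by (simp add: F.normal_iff_subgroup K)
  show "tensor_lift G f \<in> hom (tensor_group S ra la M N) G"
  proof (rule homI)
    fix X assume "X \<in> carrier (tensor_group S ra la M N)"
    then show "tensor_lift G f X \<in> carrier G"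
      by (auto simp: tensor_group_def carrier_FactGroup val h.hom_closed
          simp del: carrier_free_Abelian_group_iff)
  next
    fix X Y
    assume "X \<in> carrier (tensor_group S ra la M N)" "Y \<in> carrier (tensor_group S ra la M N)"
    then obtain x y where xy: "x \<in> carrier ?F" "y \<in> carrier ?F"
        "X = ?K #>\<^bsub>?F\<^esub> x" "Y = ?K #>\<^bsub>?F\<^esub> y"
      by (auto simp: tensor_group_def carrier_FactGroup simp del: carrier_free_Abelian_group_iff)
    then have "X \<otimes>\<^bsub>tensor_group S ra la M N\<^esub> Y = ?K #>\<^bsub>?F\<^esub> (x \<otimes>\<^bsub>?F\<^esub> y)"
      using normal.rcos_sum [OF nrm] by (simp add: tensor_group_def)
    then show "tensor_lift G f (X \<otimes>\<^bsub>tensor_group S ra la M N\<^esub> Y) =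
        tensor_lift G f X \<otimes>\<^bsub>G\<^esub> tensor_lift G f Y"
      using val [OF F.m_closed [OF xy(1,2)]] h.hom_mult [OF xy(1,2)] by (simp add: xy(3,4) val [OF xy(1)] val [OF xy(2)])
  qed
  show "tensor_lift G f (tensor_elem S ra la M N m n) = f (m, n)"
    if "m \<in> carrier M" "n \<in> carrier N"
    using that val [of "frag_of (m, n)"] by (simp add: tensor_elem_def ext(2))
qed

text \<open>
  For modules over a commutative ring \<open>R\<close> the tensor product is again an \<open>R\<close>-module; if both factors
  are algebras it carries the product \<open>(a \<otimes> h)(b \<otimes> k) = ab \<otimes> hk\<close>.  The fields \<open>mult\<close> and \<open>one\<close>
  are meaningful only in the latter case.
\<close>

definition tensor_R ::
    "'r ring \<Rightarrow> ('r, 'm) module \<Rightarrow> ('r, 'n) module \<Rightarrow> ('m \<times> 'n \<Rightarrow>\<^sub>0 int) set monoid"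
  where "tensor_R R M N =
    tensor_group (carrier R) (\<lambda>m r. r \<odot>\<^bsub>M\<^esub> m) (\<lambda>r n. r \<odot>\<^bsub>N\<^esub> n) M N"

definition pure_tensor ::
    "'r ring \<Rightarrow> ('r, 'm) module \<Rightarrow> ('r, 'n) module \<Rightarrow> 'm \<Rightarrow> 'n \<Rightarrow> ('m \<times> 'n \<Rightarrow>\<^sub>0 int) set"
  where "pure_tensor R M N =
    tensor_elem (carrier R) (\<lambda>m r. r \<odot>\<^bsub>M\<^esub> m) (\<lambda>r n. r \<odot>\<^bsub>N\<^esub> n) M N"

definition tensor ::
    "'r ring \<Rightarrow> ('r, 'm) module \<Rightarrow> ('r, 'n) module \<Rightarrow> ('r, ('m \<times> 'n \<Rightarrow>\<^sub>0 int) set) module"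
  where "tensor R M N =
    \<lparr>carrier = carrier (tensor_R R M N),
     monoid.mult = (\<lambda>X Y. tensor_lift (tensor_R R M N)
       (\<lambda>(a, h). tensor_lift (tensor_R R M N)
         (\<lambda>(b, k). pure_tensor R M N (a \<otimes>\<^bsub>M\<^esub> b) (h \<otimes>\<^bsub>N\<^esub> k)) Y) X),
     one = pure_tensor R M N \<one>\<^bsub>M\<^esub> \<one>\<^bsub>N\<^esub>,
     zero = one (tensor_R R M N),
     add = monoid.mult (tensor_R R M N),
     smult = (\<lambda>r. tensor_lift (tensor_R R M N) (\<lambda>(m, n). pure_tensor R M N (r \<odot>\<^bsub>M\<^esub> m) n))\<rparr>"

text \<open>The map \<open>f \<otimes> g\<close> into \<open>M' \<otimes> N'\<close>.\<close>

definition tensor_map ::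
    "'r ring \<Rightarrow> ('r, 'm) module \<Rightarrow> ('r, 'n) module \<Rightarrow> ('p \<Rightarrow> 'm) \<Rightarrow> ('q \<Rightarrow> 'n) \<Rightarrow>
     ('p \<times> 'q \<Rightarrow>\<^sub>0 int) set \<Rightarrow> ('m \<times> 'n \<Rightarrow>\<^sub>0 int) set"
  where "tensor_map R M' N' f g =
    tensor_lift (add_monoid (tensor R M' N')) (\<lambda>(m, n). pure_tensor R M' N' (f m) (g n))"

text \<open>The isomorphism \<open>(M \<otimes> N) \<otimes> P \<rightarrow> M \<otimes> (N \<otimes> P)\<close>.\<close>

definition tensor_assoc ::
    "'r ring \<Rightarrow> ('r, 'm) module \<Rightarrow> ('r, 'n) module \<Rightarrow> ('r, 'p) module \<Rightarrow>
     (('m \<times> 'n \<Rightarrow>\<^sub>0 int) set \<times> 'p \<Rightarrow>\<^sub>0 int) set \<Rightarrow> ('m \<times> ('n \<times> 'p \<Rightarrow>\<^sub>0 int) set \<Rightarrow>\<^sub>0 int) set"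
  where "tensor_assoc R M N P =
    tensor_lift (add_monoid (tensor R M (tensor R N P)))
      (\<lambda>(X, p). tensor_lift (add_monoid (tensor R M (tensor R N P)))
        (\<lambda>(m, n). pure_tensor R M (tensor R N P) m (pure_tensor R N P n p)) X)"


section \<open>Linear maps, purity, algebras\<close>

definition linear_map :: "'r ring \<Rightarrow> ('r, 'm) module \<Rightarrow> ('r, 'n) module \<Rightarrow> ('m \<Rightarrow> 'n) \<Rightarrow> bool"
  where "linear_map R M N f \<longleftrightarrow>
    f \<in> carrier M \<rightarrow> carrier N \<and>
    (\<forall>x\<in>carrier M. \<forall>y\<in>carrier M. f (x \<oplus>\<^bsub>M\<^esub> y) = f x \<oplus>\<^bsub>N\<^esub> f y) \<and>
    (\<forall>r\<in>carrier R. \<forall>x\<in>carrier M. f (r \<odot>\<^bsub>M\<^esub> x) = r \<odot>\<^bsub>N\<^esub> f x)"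

definition regular_module :: "'r ring \<Rightarrow> ('r, 'r) module"
  where "regular_module R =
    \<lparr>carrier = carrier R, monoid.mult = monoid.mult R, one = one R, zero = zero R, add = add R,
     smult = monoid.mult R\<rparr>"

text \<open>
  A monomorphism \<open>f: M \<rightarrow> N\<close> is pure if \<open>f \<otimes> P\<close> is injective for every \<open>R\<close>-module \<open>P\<close>.  A formula
  cannot quantify over the type of \<open>P\<close>, so that type is the parameter \<open>'p\<close>.  Since \<open>\<otimes>\<close> commutes with
  filtered colimits, finitely presented \<open>P\<close> suffice; these are quotients \<open>R\<^sup>n / K\<close> and hence
  have isomorphic copies whenever \<open>(nat \<Rightarrow> 'r) set\<close> embeds into \<open>'p\<close>.  For every such \<open>'p\<close> the
  predicate is therefore purity, and in particular does not depend on \<open>'p\<close>.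
\<close>

definition pure_mono ::
    "'p itself \<Rightarrow> 'r ring \<Rightarrow> ('r, 'm) module \<Rightarrow> ('r, 'n) module \<Rightarrow> ('m \<Rightarrow> 'n) \<Rightarrow> bool"
  where "pure_mono _ R M N f \<longleftrightarrow>
    linear_map R M N f \<and> inj_on f (carrier M) \<and>
    (\<forall>P :: ('r, 'p) module. module R P \<longrightarrow>
       inj_on (tensor_map R N P f (\<lambda>x. x)) (carrier (tensor R M P)))"

text \<open>The library's \<open>algebra\<close> is commutative.\<close>

locale assoc_algebra = module R A + ring A for R :: "'r ring" and A :: "('r, 'a) module" +
  assumes smult_mult_left:
    "\<lbrakk>r \<in> carrier R; x \<in> carrier A; y \<in> carrier A\<rbrakk> \<Longrightarrow>
      (r \<odot>\<^bsub>A\<^esub> x) \<otimes>\<^bsub>A\<^esub> y = r \<odot>\<^bsub>A\<^esub> (x \<otimes>\<^bsub>A\<^esub> y)"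
    and smult_mult_right:
    "\<lbrakk>r \<in> carrier R; x \<in> carrier A; y \<in> carrier A\<rbrakk> \<Longrightarrow>
      x \<otimes>\<^bsub>A\<^esub> (r \<odot>\<^bsub>A\<^esub> y) = r \<odot>\<^bsub>A\<^esub> (x \<otimes>\<^bsub>A\<^esub> y)"

definition algebra_hom :: "'r ring \<Rightarrow> ('r, 'a) module \<Rightarrow> ('r, 'b) module \<Rightarrow> ('a \<Rightarrow> 'b) \<Rightarrow> bool"
  where "algebra_hom R A B f \<longleftrightarrow> linear_map R A B f \<and> f \<in> ring_hom A B"

definition algebra_unit :: "('r, 'a) module \<Rightarrow> 'r \<Rightarrow> 'a"
  where "algebra_unit A r = r \<odot>\<^bsub>A\<^esub> \<one>\<^bsub>A\<^esub>"


section \<open>Hopf algebras and comodule algebras\<close>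

locale coalgebra = module R C for R :: "'r ring" and C :: "('r, 'c) module" +
  fixes \<Delta> :: "'c \<Rightarrow> ('c \<times> 'c \<Rightarrow>\<^sub>0 int) set" and \<epsilon> :: "'c \<Rightarrow> 'r"
  assumes comult_linear: "linear_map R C (tensor R C C) \<Delta>"
    and counit_linear: "linear_map R C (regular_module R) \<epsilon>"
    and coassoc: "c \<in> carrier C \<Longrightarrow>
      tensor_assoc R C C C (tensor_map R (tensor R C C) C \<Delta> (\<lambda>x. x) (\<Delta> c)) =
      tensor_map R C (tensor R C C) (\<lambda>x. x) \<Delta> (\<Delta> c)"
    and counit_left: "c \<in> carrier C \<Longrightarrow>
      tensor_lift (add_monoid C) (\<lambda>(x, y). \<epsilon> x \<odot>\<^bsub>C\<^esub> y) (\<Delta> c) = c"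
    and counit_right: "c \<in> carrier C \<Longrightarrow>
      tensor_lift (add_monoid C) (\<lambda>(x, y). \<epsilon> y \<odot>\<^bsub>C\<^esub> x) (\<Delta> c) = c"

locale hopf_algebra = assoc_algebra R H + coalgebra R H \<Delta> \<epsilon>
  for R :: "'r ring" and H :: "('r, 'h) module"
    and \<Delta> :: "'h \<Rightarrow> ('h \<times> 'h \<Rightarrow>\<^sub>0 int) set" and \<epsilon> :: "'h \<Rightarrow> 'r" +
  fixes antipode :: "'h \<Rightarrow> 'h"
  assumes comult_hom: "algebra_hom R H (tensor R H H) \<Delta>"
    and counit_hom: "algebra_hom R H (regular_module R) \<epsilon>"
    and antipode_linear: "linear_map R H H antipode"
    and antipode_left: "h \<in> carrier H \<Longrightarrow>
      tensor_lift (add_monoid H) (\<lambda>(x, y). antipode x \<otimes>\<^bsub>H\<^esub> y) (\<Delta> h) = algebra_unit H (\<epsilon> h)"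
    and antipode_right: "h \<in> carrier H \<Longrightarrow>
      tensor_lift (add_monoid H) (\<lambda>(x, y). x \<otimes>\<^bsub>H\<^esub> antipode y) (\<Delta> h) = algebra_unit H (\<epsilon> h)"

locale comodule_algebra = A: assoc_algebra R A + H: hopf_algebra R H \<Delta> \<epsilon> antipode
  for R :: "'r ring" and H :: "('r, 'h) module"
    and \<Delta> :: "'h \<Rightarrow> ('h \<times> 'h \<Rightarrow>\<^sub>0 int) set" and \<epsilon> :: "'h \<Rightarrow> 'r" and antipode :: "'h \<Rightarrow> 'h"
    and A :: "('r, 'a) module" +
  fixes \<delta> :: "'a \<Rightarrow> ('a \<times> 'h \<Rightarrow>\<^sub>0 int) set"
  assumes coaction_hom: "algebra_hom R A (tensor R A H) \<delta>"
    and coaction_coassoc: "a \<in> carrier A \<Longrightarrow>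
      tensor_assoc R A H H (tensor_map R (tensor R A H) H \<delta> (\<lambda>x. x) (\<delta> a)) =
      tensor_map R A (tensor R H H) (\<lambda>x. x) \<Delta> (\<delta> a)"
    and coaction_counital: "a \<in> carrier A \<Longrightarrow>
      tensor_lift (add_monoid A) (\<lambda>(x, h). \<epsilon> h \<odot>\<^bsub>A\<^esub> x) (\<delta> a) = a"


section \<open>Subalgebras and generalised quotients\<close>

definition Sub_Alg :: "'r ring \<Rightarrow> ('r, 'a) module \<Rightarrow> 'a set \<Rightarrow> 'a set gorder"
  where "Sub_Alg R A B =
    \<lparr>carrier = {S. subring S A \<and> submodule S R A \<and> B \<subseteq> S}, eq = (=), le = (\<subseteq>)\<rparr>"

text \<open>
  In the coideal condition, \<open>I \<otimes> H + H \<otimes> I\<close> stands for its image in \<open>H \<otimes> H\<close>, which is the kernel of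
  \<open>\<pi> \<otimes> \<pi>: H \<otimes> H \<rightarrow> H/I \<otimes> H/I\<close>.
\<close>

definition right_ideal_coideal ::
    "'r ring \<Rightarrow> ('r, 'h) module \<Rightarrow> ('h \<Rightarrow> ('h \<times> 'h \<Rightarrow>\<^sub>0 int) set) \<Rightarrow> ('h \<Rightarrow> 'r) \<Rightarrow> 'h set \<Rightarrow> bool"
  where "right_ideal_coideal R H \<Delta> \<epsilon> I \<longleftrightarrow>
    submodule I R H \<and>
    (\<forall>x\<in>I. \<forall>h\<in>carrier H. x \<otimes>\<^bsub>H\<^esub> h \<in> I) \<and>
    (\<forall>x\<in>I. \<Delta> x \<in> generate (add_monoid (tensor R H H))
       ({pure_tensor R H H y h | y h. y \<in> I \<and> h \<in> carrier H} \<union>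
        {pure_tensor R H H h y | y h. y \<in> I \<and> h \<in> carrier H})) \<and>
    (\<forall>x\<in>I. \<epsilon> x = \<zero>\<^bsub>R\<^esub>)"

text \<open>A one-sided ideal gives no ring structure on \<open>H/I\<close>; only the \<open>R\<close>-module structure is used.\<close>

definition quotient_module :: "('r, 'h) module \<Rightarrow> 'h set \<Rightarrow> ('r, 'h set) module"
  where "quotient_module H I =
    \<lparr>carrier = a_rcosets\<^bsub>H\<^esub> I, monoid.mult = undefined, one = undefined,
     zero = I, add = set_add H, smult = (\<lambda>r X. \<Union>x\<in>X. I +>\<^bsub>H\<^esub> (r \<odot>\<^bsub>H\<^esub> x))\<rparr>"

text \<open>The zero of \<open>Q = H/I\<close> is the coset \<open>I\<close>.\<close>

definition quotient_proj :: "('r, 'h) module \<Rightarrow> ('r, 'h set) module \<Rightarrow> 'h \<Rightarrow> 'h set"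
  where "quotient_proj H Q h = \<zero>\<^bsub>Q\<^esub> +>\<^bsub>H\<^esub> h"

definition Quot_gen ::
    "'r ring \<Rightarrow> ('r, 'h) module \<Rightarrow> ('h \<Rightarrow> ('h \<times> 'h \<Rightarrow>\<^sub>0 int) set) \<Rightarrow> ('h \<Rightarrow> 'r) \<Rightarrow>
     ('r, 'h set) module gorder"
  where "Quot_gen R H \<Delta> \<epsilon> =
    \<lparr>carrier = quotient_module H ` {I. right_ideal_coideal R H \<Delta> \<epsilon> I},
     eq = (=),
     le = (\<lambda>P Q. \<exists>I J. Q = quotient_module H I \<and> P = quotient_module H J \<and> I \<subseteq> J)\<rparr>"


section \<open>Coinvariants, canonical maps and Galois connections\<close>

definition coinvariants_H ::
    "'r ring \<Rightarrow> ('r, 'h) module \<Rightarrow> ('r, 'a) module \<Rightarrow> ('a \<Rightarrow> ('a \<times> 'h \<Rightarrow>\<^sub>0 int) set) \<Rightarrow> 'a set"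
  where "coinvariants_H R H A \<delta> = {a \<in> carrier A. \<delta> a = pure_tensor R A H a \<one>\<^bsub>H\<^esub>}"

definition coinvariants ::
    "'r ring \<Rightarrow> ('r, 'h) module \<Rightarrow> ('r, 'a) module \<Rightarrow> ('a \<Rightarrow> ('a \<times> 'h \<Rightarrow>\<^sub>0 int) set) \<Rightarrow>
     ('r, 'h set) module \<Rightarrow> 'a set"
  where "coinvariants R H A \<delta> Q =
    {a \<in> carrier A. tensor_map R A Q (\<lambda>x. x) (quotient_proj H Q) (\<delta> a) =
       pure_tensor R A Q a (quotient_proj H Q \<one>\<^bsub>H\<^esub>)}"

text \<open>\<open>A \<otimes>\<^sub>S A\<close> for a subalgebra \<open>S\<close> of \<open>A\<close>.\<close>

definition tensor_over ::
    "('r, 'a) module \<Rightarrow> 'a set \<Rightarrow> ('a \<times> 'a \<Rightarrow>\<^sub>0 int) set monoid"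
  where "tensor_over A S = tensor_group S (monoid.mult A) (monoid.mult A) A A"

text \<open>\<open>a \<otimes> b \<mapsto> a b\<^sub>0 \<otimes> p(b\<^sub>1)\<close> with values in \<open>A \<otimes> P\<close>, for \<open>p: H \<rightarrow> P\<close>.\<close>

definition can ::
    "'r ring \<Rightarrow> ('r, 'a) module \<Rightarrow> ('a \<Rightarrow> ('a \<times> 'h \<Rightarrow>\<^sub>0 int) set) \<Rightarrow> ('r, 'p) module \<Rightarrow> ('h \<Rightarrow> 'p) \<Rightarrow>
     ('a \<times> 'a \<Rightarrow>\<^sub>0 int) set \<Rightarrow> ('a \<times> 'p \<Rightarrow>\<^sub>0 int) set"
  where "can R A \<delta> P p =
    tensor_lift (add_monoid (tensor R A P))
      (\<lambda>(a, b). tensor_map R A P (\<lambda>x. a \<otimes>\<^bsub>A\<^esub> x) p (\<delta> b))"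

definition can_H ::
    "'r ring \<Rightarrow> ('r, 'h) module \<Rightarrow> ('r, 'a) module \<Rightarrow> ('a \<Rightarrow> ('a \<times> 'h \<Rightarrow>\<^sub>0 int) set) \<Rightarrow>
     ('a \<times> 'a \<Rightarrow>\<^sub>0 int) set \<Rightarrow> ('a \<times> 'h \<Rightarrow>\<^sub>0 int) set"
  where "can_H R H A \<delta> = can R A \<delta> H (\<lambda>h. h)"

definition can_Q ::
    "'r ring \<Rightarrow> ('r, 'h) module \<Rightarrow> ('r, 'a) module \<Rightarrow> ('a \<Rightarrow> ('a \<times> 'h \<Rightarrow>\<^sub>0 int) set) \<Rightarrow>
     ('r, 'h set) module \<Rightarrow> ('a \<times> 'a \<Rightarrow>\<^sub>0 int) set \<Rightarrow> ('a \<times> 'h set \<Rightarrow>\<^sub>0 int) set"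
  where "can_Q R H A \<delta> Q = can R A \<delta> Q (quotient_proj H Q)"

definition Q_Galois ::
    "'r ring \<Rightarrow> ('r, 'h) module \<Rightarrow> ('r, 'a) module \<Rightarrow> ('a \<Rightarrow> ('a \<times> 'h \<Rightarrow>\<^sub>0 int) set) \<Rightarrow>
     ('r, 'h set) module \<Rightarrow> bool"
  where "Q_Galois R H A \<delta> Q \<longleftrightarrow>
    bij_betw (can_Q R H A \<delta> Q)
      (carrier (tensor_over A (coinvariants R H A \<delta> Q))) (carrier (tensor R A Q))"

text \<open>The library's Galois connections are monotone.\<close>

definition antitone_galois_connection ::
    "'x gorder \<Rightarrow> 'y gorder \<Rightarrow> ('y \<Rightarrow> 'x) \<Rightarrow> ('x \<Rightarrow> 'y) \<Rightarrow> bool"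
  where "antitone_galois_connection X Y \<phi> \<psi> \<longleftrightarrow>
    \<phi> \<in> carrier Y \<rightarrow> carrier X \<and> \<psi> \<in> carrier X \<rightarrow> carrier Y \<and>
    (\<forall>P\<in>carrier Y. \<forall>Q\<in>carrier Y. P \<sqsubseteq>\<^bsub>Y\<^esub> Q \<longrightarrow> \<phi> Q \<sqsubseteq>\<^bsub>X\<^esub> \<phi> P) \<and>
    (\<forall>S\<in>carrier X. \<forall>T\<in>carrier X. S \<sqsubseteq>\<^bsub>X\<^esub> T \<longrightarrow> \<psi> T \<sqsubseteq>\<^bsub>Y\<^esub> \<psi> S) \<and>
    (\<forall>S\<in>carrier X. S \<sqsubseteq>\<^bsub>X\<^esub> \<phi> (\<psi> S)) \<and>
    (\<forall>Q\<in>carrier Y. Q \<sqsubseteq>\<^bsub>Y\<^esub> \<psi> (\<phi> Q))"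

definition closed_element :: "('y \<Rightarrow> 'x) \<Rightarrow> ('x \<Rightarrow> 'y) \<Rightarrow> 'y \<Rightarrow> bool"
  where "closed_element \<phi> \<psi> Q \<longleftrightarrow> \<psi> (\<phi> Q) = Q"

end

theory Submission
  imports Defs
begin

text \<open>
  Let \<open>Q = H/I\<close>, \<open>S = \<phi>(Q)\<close> and \<open>\<psi>(S) = H/J\<close>, where \<open>\<phi>(Q)\<close> is
  the algebra of coinvariants of \<open>Q\<close>.  The Galois connection gives \<open>J \<subseteq> I\<close>, and \<open>S\<close> consists of
  coinvariants of \<open>H/J\<close>; what remains is \<open>I \<subseteq> J\<close>.

  Because \<open>S\<close> is coinvariant for both quotients, both canonical maps are defined on \<open>A \<otimes>\<^sub>S A\<close>
  (\<open>can_balanced\<close>, which rests on \<open>I\<close> and \<open>J\<close> being right ideals, see \<open>push_coaction_coinv\<close>), and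
  precomposed with the projection \<open>A \<otimes>\<^sub>B A \<rightarrow> A \<otimes>\<^sub>S A\<close> each of them is \<open>can_H\<close> followed by \<open>A \<otimes> H \<rightarrow> A \<otimes> H/I\<close>
  or \<open>A \<otimes> H \<rightarrow> A \<otimes> H/J\<close> (\<open>can_restrict_base\<close>).  For \<open>h \<in> I\<close> write \<open>1 \<otimes> h = can_H X\<close>, by surjectivity
  of \<open>can_H\<close>.  The image of \<open>X\<close> in \<open>A \<otimes>\<^sub>S A\<close> is sent by the canonical map of \<open>H/I\<close> to the class of \<open>1 \<otimes> h\<close> in
  \<open>A \<otimes> H/I\<close>, which is zero.  As that map is injective, the image of \<open>X\<close> is already zero, and applying the
  canonical map of \<open>H/J\<close> shows that \<open>1 \<otimes> h\<close> is zero in \<open>A \<otimes> H/J\<close> as well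
  (\<open>pure_eq_zero_of_can_inj\<close>).  Since \<open>R \<rightarrow> A\<close> is pure, \<open>H/J \<rightarrow> A \<otimes> H/J\<close> is injective
  (\<open>pure_one_eq_zero\<close>), and so \<open>h \<in> J\<close>.
\<close>

section \<open>Tensor products of abelian groups\<close>

text \<open>
  The base \<open>S\<close> is a set acting on both factors, so that the products over \<open>R\<close>, where \<open>ra\<close> and \<open>la\<close> are
  scalar multiplications, and over subalgebras of \<open>A\<close>, where they are products of \<open>A\<close>, are instances.
\<close>

locale tensor_factors = M: abelian_group M + N: abelian_group N
  for S :: "'s set" and ra :: "'m \<Rightarrow> 's \<Rightarrow> 'm" and la :: "'s \<Rightarrow> 'n \<Rightarrow> 'n"
    and M :: "('m, 'x) ring_scheme" and N :: "('n, 'y) ring_scheme" +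
  assumes ra_closed: "\<lbrakk>m \<in> carrier M; s \<in> S\<rbrakk> \<Longrightarrow> ra m s \<in> carrier M"
    and la_closed: "\<lbrakk>n \<in> carrier N; s \<in> S\<rbrakk> \<Longrightarrow> la s n \<in> carrier N"
begin

abbreviation free where "free \<equiv> free_Abelian_group (carrier M \<times> carrier N)"
abbreviation ker where "ker \<equiv> tensor_kernel S ra la M N"
abbreviation T where "T \<equiv> tensor_group S ra la M N"
abbreviation elem where "elem \<equiv> tensor_elem S ra la M N"

sublocale F: comm_group free
  by (rule abelian_free_Abelian_group)

lemma relations_subset: "tensor_relations S ra la M N \<subseteq> carrier free"
  unfolding tensor_relations_def
  by (auto simp: ra_closed la_closed subset_iff dest!: subsetD [OF keys_diff])

lemma ker_subgroup: "subgroup ker free"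
  unfolding tensor_kernel_def by (rule F.generate_is_subgroup [OF relations_subset])

lemma ker_normal: "ker \<lhd> free"
  by (simp add: F.normal_iff_subgroup ker_subgroup)

lemma tensor_comm_group: "comm_group T"
  unfolding tensor_group_def by (rule F.abelian_FactGroup [OF ker_subgroup])

lemma coset_hom: "(\<lambda>c. ker #>\<^bsub>free\<^esub> c) \<in> hom free T"
  unfolding tensor_group_def by (rule normal.r_coset_hom_Mod [OF ker_normal])

lemma elem_closed: "\<lbrakk>m \<in> carrier M; n \<in> carrier N\<rbrakk> \<Longrightarrow> elem m n \<in> carrier T"
  using hom_in_carrier [OF coset_hom, of "frag_of (m, n)"] by (simp add: tensor_elem_def)

lemma coset_eqI:
  assumes "x - y \<in> ker" "y \<in> carrier free"
  shows "ker #>\<^bsub>free\<^esub> x = ker #>\<^bsub>free\<^esub> y"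
proof -
  have "x \<in> ker #>\<^bsub>free\<^esub> y"
    using assms(1) by (auto simp: r_coset_def intro!: bexI [of _ "x - y"])
  then show ?thesis
    using F.repr_independence [OF _ assms(2) ker_subgroup] by simp
qed

lemma relation_in_ker: "x \<in> tensor_relations S ra la M N \<Longrightarrow> x \<in> ker"
  unfolding tensor_kernel_def by (rule generate.incl)

lemma elem_add_left:
  assumes "m \<in> carrier M" "m' \<in> carrier M" "n \<in> carrier N"
  shows "elem (m \<oplus>\<^bsub>M\<^esub> m') n = elem m n \<otimes>\<^bsub>T\<^esub> elem m' n"
proof -
  let ?a = "frag_of (m, n)" and ?b = "frag_of (m', n)"
  have c: "?a \<in> carrier free" "?b \<in> carrier free"
    using assms by simp_all
  have "frag_of (m \<oplus>\<^bsub>M\<^esub> m', n) - (?a \<otimes>\<^bsub>free\<^esub> ?b) \<in> ker"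
    using assms by (intro relation_in_ker) (auto simp: tensor_relations_def diff_diff_add)
  then show ?thesis
    unfolding tensor_elem_def hom_mult [OF coset_hom c, symmetric]
    by (rule coset_eqI) (rule F.m_closed [OF c])
qed

lemma elem_add_right:
  assumes "m \<in> carrier M" "n \<in> carrier N" "n' \<in> carrier N"
  shows "elem m (n \<oplus>\<^bsub>N\<^esub> n') = elem m n \<otimes>\<^bsub>T\<^esub> elem m n'"
proof -
  let ?a = "frag_of (m, n)" and ?b = "frag_of (m, n')"
  have c: "?a \<in> carrier free" "?b \<in> carrier free"
    using assms by simp_all
  have "frag_of (m, n \<oplus>\<^bsub>N\<^esub> n') - (?a \<otimes>\<^bsub>free\<^esub> ?b) \<in> ker"
    using assms by (intro relation_in_ker) (auto simp: tensor_relations_def diff_diff_add)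
  then show ?thesis
    unfolding tensor_elem_def hom_mult [OF coset_hom c, symmetric]
    by (rule coset_eqI) (rule F.m_closed [OF c])
qed

lemma elem_balanced:
  assumes "m \<in> carrier M" "s \<in> S" "n \<in> carrier N"
  shows "elem (ra m s) n = elem m (la s n)"
  unfolding tensor_elem_def
  by (rule coset_eqI, rule relation_in_ker)
     (use assms in \<open>auto simp: tensor_relations_def la_closed\<close>)

lemma balanced_elem: "balanced_map S ra la M N T (\<lambda>(m, n). elem m n)"
  unfolding balanced_map_def
  by (auto simp: elem_closed elem_add_left elem_add_right elem_balanced)

text \<open>
  The elements \<open>m \<otimes> n\<close> generate the tensor product, so they separate its homomorphisms.  All
  identities of maps on tensor products below are checked on them.
\<close>

lemma tensor_hom_eqI:
  assumes G: "group G" and f: "f \<in> hom T G" and g: "g \<in> hom T G"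
    and eq: "\<And>m n. \<lbrakk>m \<in> carrier M; n \<in> carrier N\<rbrakk> \<Longrightarrow> f (elem m n) = g (elem m n)"
    and X: "X \<in> carrier T"
  shows "f X = g X"
proof -
  interpret G: group G by (fact G)
  interpret f: group_hom free G "\<lambda>c. f (ker #>\<^bsub>free\<^esub> c)"
    using hom_compose [OF coset_hom f] by unfold_locales (simp add: comp_def)
  interpret g: group_hom free G "\<lambda>c. g (ker #>\<^bsub>free\<^esub> c)"
    using hom_compose [OF coset_hom g] by unfold_locales (simp add: comp_def)
  obtain c where c: "c \<in> carrier free" "X = ker #>\<^bsub>free\<^esub> c"
    using X by (auto simp: tensor_group_def carrier_FactGroup
        simp del: carrier_free_Abelian_group_iff)
  have "Poly_Mapping.keys c \<subseteq> carrier M \<times> carrier N"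
    using c(1) by simp
  then have "c \<in> carrier free \<and> f (ker #>\<^bsub>free\<^esub> c) = g (ker #>\<^bsub>free\<^esub> c)"
  proof (induction rule: frag_induction)
    case zero
    show ?case using f.hom_one g.hom_one by simp
  next
    case (one x)
    then show ?case using eq [unfolded tensor_elem_def] by (cases x) simp
  next
    case (diff a b)
    then have a: "a \<in> carrier free" and b: "b \<in> carrier free" by blast+
    have ab: "a - b = a \<otimes>\<^bsub>free\<^esub> inv\<^bsub>free\<^esub> b" using b by simp
    have "f (ker #>\<^bsub>free\<^esub> (a - b)) = g (ker #>\<^bsub>free\<^esub> (a - b))"
      unfolding ab f.hom_mult [OF a F.inv_closed [OF b]] g.hom_mult [OF a F.inv_closed [OF b]]
        f.hom_inv [OF b] g.hom_inv [OF b]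
      using diff by metis
    moreover have "a - b \<in> carrier free"
      unfolding ab by (rule F.m_closed [OF a F.inv_closed [OF b]])
    ultimately show ?case by blast
  qed
  then show ?thesis by (simp add: c(2))
qed

end


section \<open>Tensor products of modules\<close>

locale module_pair = M: module R M + N: module R N
  for R :: "'r ring" and M :: "('r, 'm) module" and N :: "('r, 'n) module"

sublocale module_pair \<subseteq> tensor_factors "carrier R" "\<lambda>m r. r \<odot>\<^bsub>M\<^esub> m" "\<lambda>r n. r \<odot>\<^bsub>N\<^esub> n" M N
  by unfold_locales auto

lemma carrier_tensor: "carrier (tensor R M N) = carrier (tensor_R R M N)"
  by (simp add: tensor_def)

lemma add_tensor: "X \<oplus>\<^bsub>tensor R M N\<^esub> Y = X \<otimes>\<^bsub>tensor_R R M N\<^esub> Y"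
  by (simp add: tensor_def)

lemma zero_tensor: "\<zero>\<^bsub>tensor R M N\<^esub> = \<one>\<^bsub>tensor_R R M N\<^esub>"
  by (simp add: tensor_def)

text \<open>
  The additive group of \<open>tensor R M N\<close> still carries the scalar multiplication in its record and so
  differs in type from \<open>tensor_R R M N\<close>; the homomorphisms out of the two agree.
\<close>

lemma hom_from_tensor: "hom (add_monoid (tensor R M N)) G = hom (tensor_R R M N) G"
  by (simp add: hom_def carrier_tensor add_tensor)

context module_pair
begin

lemma tensor_R_comm_group: "comm_group (tensor_R R M N)"
  unfolding tensor_R_def by (rule tensor_comm_group)

lemma tensor_abelian_group: "abelian_group (tensor R M N)"
proof -
  interpret T: comm_group "tensor_R R M N" by (rule tensor_R_comm_group)
  show ?thesis
    by (rule abelian_groupI)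
       (auto simp: carrier_tensor add_tensor zero_tensor T.m_ac
         intro: T.l_inv_ex)
qed

lemma pure_closed [simp]:
  "\<lbrakk>m \<in> carrier M; n \<in> carrier N\<rbrakk> \<Longrightarrow> pure_tensor R M N m n \<in> carrier (tensor R M N)"
  by (simp add: carrier_tensor tensor_R_def pure_tensor_def elem_closed)

lemma pure_add_left:
  "\<lbrakk>m \<in> carrier M; m' \<in> carrier M; n \<in> carrier N\<rbrakk> \<Longrightarrow> pure_tensor R M N (m \<oplus>\<^bsub>M\<^esub> m') n =
    pure_tensor R M N m n \<oplus>\<^bsub>tensor R M N\<^esub> pure_tensor R M N m' n"
  by (simp add: add_tensor tensor_R_def pure_tensor_def elem_add_left)

lemma pure_add_right:
  "\<lbrakk>m \<in> carrier M; n \<in> carrier N; n' \<in> carrier N\<rbrakk> \<Longrightarrow> pure_tensor R M N m (n \<oplus>\<^bsub>N\<^esub> n') =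
    pure_tensor R M N m n \<oplus>\<^bsub>tensor R M N\<^esub> pure_tensor R M N m n'"
  by (simp add: add_tensor tensor_R_def pure_tensor_def elem_add_right)

lemma pure_smult:
  "\<lbrakk>m \<in> carrier M; r \<in> carrier R; n \<in> carrier N\<rbrakk> \<Longrightarrow>
    pure_tensor R M N (r \<odot>\<^bsub>M\<^esub> m) n = pure_tensor R M N m (r \<odot>\<^bsub>N\<^esub> n)"
  by (simp add: pure_tensor_def elem_balanced)

lemma pure_zero_right:
  assumes m: "m \<in> carrier M"
  shows "pure_tensor R M N m \<zero>\<^bsub>N\<^esub> = \<zero>\<^bsub>tensor R M N\<^esub>"
proof -
  interpret T: abelian_group "tensor R M N" by (rule tensor_abelian_group)
  show ?thesis
    using pure_add_right [OF m N.zero_closed N.zero_closed] m by simp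
qed

lemma hom_eqI:
  assumes "abelian_group G"
    and "f \<in> hom (add_monoid (tensor R M N)) (add_monoid G)"
    and "g \<in> hom (add_monoid (tensor R M N)) (add_monoid G)"
    and "\<And>m n. \<lbrakk>m \<in> carrier M; n \<in> carrier N\<rbrakk> \<Longrightarrow>
      f (pure_tensor R M N m n) = g (pure_tensor R M N m n)"
    and "X \<in> carrier (tensor R M N)"
  shows "f X = g X"
  by (rule tensor_hom_eqI [OF abelian_group.a_group [OF assms(1)]
        assms(2,3) [unfolded hom_from_tensor tensor_R_def]
        assms(4) [unfolded pure_tensor_def] assms(5) [unfolded carrier_tensor tensor_R_def]])

lemma lift_universal:
  assumes "abelian_group G"
    and "balanced_map (carrier R) (\<lambda>m r. r \<odot>\<^bsub>M\<^esub> m) (\<lambda>r n. r \<odot>\<^bsub>N\<^esub> n) M N (add_monoid G) f"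
  shows "tensor_lift (add_monoid G) f \<in> hom (add_monoid (tensor R M N)) (add_monoid G)"
    and "\<lbrakk>m \<in> carrier M; n \<in> carrier N\<rbrakk> \<Longrightarrow>
      tensor_lift (add_monoid G) f (pure_tensor R M N m n) = f (m, n)"
  unfolding hom_from_tensor tensor_R_def pure_tensor_def
  by (rule tensor_lift_universal [OF abelian_group.a_comm_group [OF assms(1)] assms(2)
        _ _ M.abelian_group_axioms N.abelian_group_axioms]; simp)+

end

lemma linear_mapD:
  assumes "linear_map R M N f"
  shows "x \<in> carrier M \<Longrightarrow> f x \<in> carrier N"
    and "\<lbrakk>x \<in> carrier M; y \<in> carrier M\<rbrakk> \<Longrightarrow> f (x \<oplus>\<^bsub>M\<^esub> y) = f x \<oplus>\<^bsub>N\<^esub> f y"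
    and "\<lbrakk>r \<in> carrier R; x \<in> carrier M\<rbrakk> \<Longrightarrow> f (r \<odot>\<^bsub>M\<^esub> x) = r \<odot>\<^bsub>N\<^esub> f x"
  using assms by (auto simp: linear_map_def)

lemma linear_map_id: "linear_map R M M (\<lambda>x. x)"
  by (simp add: linear_map_def)

lemma linear_map_comp:
  "\<lbrakk>linear_map R M N f; linear_map R N P g\<rbrakk> \<Longrightarrow> linear_map R M P (\<lambda>x. g (f x))"
  by (simp add: linear_map_def Pi_iff)

lemma tensor_map_hom:
  assumes "module_pair R M N" and "module_pair R M' N'"
    and f: "linear_map R M M' f" and g: "linear_map R N N' g"
  shows "tensor_map R M' N' f g \<in> hom (add_monoid (tensor R M N)) (add_monoid (tensor R M' N'))"
    and "\<lbrakk>m \<in> carrier M; n \<in> carrier N\<rbrakk> \<Longrightarrow>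
      tensor_map R M' N' f g (pure_tensor R M N m n) = pure_tensor R M' N' (f m) (g n)"
proof -
  interpret MN: module_pair R M N by fact
  interpret MN': module_pair R M' N' by fact
  note l = linear_mapD [OF f] linear_mapD [OF g]
  have b: "balanced_map (carrier R) (\<lambda>m r. r \<odot>\<^bsub>M\<^esub> m) (\<lambda>r n. r \<odot>\<^bsub>N\<^esub> n) M N
      (add_monoid (tensor R M' N')) (\<lambda>(m, n). pure_tensor R M' N' (f m) (g n))"
    unfolding balanced_map_def
    by (auto simp: l MN'.pure_add_left MN'.pure_add_right MN'.pure_smult)
  note u = MN.lift_universal [OF MN'.tensor_abelian_group b]
  show "tensor_map R M' N' f g \<in> hom (add_monoid (tensor R M N)) (add_monoid (tensor R M' N'))"
    unfolding tensor_map_def by (rule u(1))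
  show "tensor_map R M' N' f g (pure_tensor R M N m n) = pure_tensor R M' N' (f m) (g n)"
    if "m \<in> carrier M" "n \<in> carrier N"
    unfolding tensor_map_def using u(2) [OF that] by simp
qed

lemma tensor_map_comp:
  assumes MN: "module_pair R M N" and MN': "module_pair R M' N'" and MN'': "module_pair R M'' N''"
    and f: "linear_map R M M' f" and g: "linear_map R N N' g"
    and f': "linear_map R M' M'' f'" and g': "linear_map R N' N'' g'"
    and X: "X \<in> carrier (tensor R M N)"
  shows "tensor_map R M'' N'' f' g' (tensor_map R M' N' f g X) =
    tensor_map R M'' N'' (\<lambda>x. f' (f x)) (\<lambda>x. g' (g x)) X"
proof -
  interpret MN: module_pair R M N by fact
  note h1 = tensor_map_hom [OF MN MN' f g] and h2 = tensor_map_hom [OF MN' MN'' f' g']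
    and h3 = tensor_map_hom [OF MN MN'' linear_map_comp [OF f f'] linear_map_comp [OF g g']]
  show ?thesis
    by (rule MN.hom_eqI [OF module_pair.tensor_abelian_group [OF MN'']
          hom_compose [OF h1(1) h2(1), unfolded comp_def] h3(1) _ X])
       (simp add: h1(2) h2(2) h3(2) linear_mapD [OF f] linear_mapD [OF g])
qed

lemma tensor_map_id:
  assumes MN: "module_pair R M N" and X: "X \<in> carrier (tensor R M N)"
  shows "tensor_map R M N (\<lambda>x. x) (\<lambda>x. x) X = X"
proof -
  interpret MN: module_pair R M N by fact
  note h = tensor_map_hom [OF MN MN linear_map_id linear_map_id]
  have id: "(\<lambda>x. x) \<in> hom (add_monoid (tensor R M N)) (add_monoid (tensor R M N))"
    by (simp add: hom_def)
  show ?thesis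
    by (rule MN.hom_eqI [OF MN.tensor_abelian_group h(1) id _ X]) (simp add: h(2))
qed


section \<open>The product of a tensor product of algebras\<close>

text \<open>
  \<open>tensor\<close> lifts its product along \<open>tensor_R R M N\<close>.  A lift depends only on the operations of
  the target, so it can be taken in the additive group of \<open>tensor R M N\<close> instead.
\<close>

lemma tensor_lift_tensor_R:
  "tensor_lift (tensor_R R M N) f = tensor_lift (add_monoid (tensor R M N)) f"
proof -
  have "free_extend (tensor_R R M N) f c = free_extend (add_monoid (tensor R M N)) f c" for c
    by (simp add: free_extend_def finprod_def int_pow_def nat_pow_def m_inv_def tensor_def
        cong: if_cong)
  then show ?thesis
    by (simp add: tensor_lift_def fun_eq_iff)
qed

lemma hom_add_pointwise:
  assumes "abelian_group G" "f \<in> hom K (add_monoid G)" "g \<in> hom K (add_monoid G)"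
  shows "(\<lambda>x. f x \<oplus>\<^bsub>G\<^esub> g x) \<in> hom K (add_monoid G)"
proof -
  interpret G: abelian_group G by fact
  show ?thesis
    using assms(2,3) by (auto simp: hom_def Pi_iff G.a_ac)
qed

locale algebra_pair = M: assoc_algebra R M + N: assoc_algebra R N
  for R :: "'r ring" and M :: "('r, 'm) module" and N :: "('r, 'n) module"

sublocale algebra_pair \<subseteq> module_pair R M N
  by unfold_locales

context algebra_pair
begin

text \<open>
  The product is a lift in its left argument of a lift in its right
  argument, so its properties are obtained from these maps, one argument at a time.
\<close>

abbreviation left_mult where
  "left_mult \<equiv> \<lambda>(a, h). tensor_lift (add_monoid (tensor R M N))
     (\<lambda>(b, k). pure_tensor R M N (a \<otimes>\<^bsub>M\<^esub> b) (h \<otimes>\<^bsub>N\<^esub> k))"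

lemma mult_eq:
  "X \<otimes>\<^bsub>tensor R M N\<^esub> Y = tensor_lift (add_monoid (tensor R M N)) (\<lambda>(a, h). left_mult (a, h) Y) X"
  unfolding tensor_lift_tensor_R [symmetric] by (simp add: tensor_def)

lemma left_mult_universal:
  assumes a: "a \<in> carrier M" and h: "h \<in> carrier N"
  shows "left_mult (a, h) \<in> hom (add_monoid (tensor R M N)) (add_monoid (tensor R M N))"
    and "\<lbrakk>b \<in> carrier M; k \<in> carrier N\<rbrakk> \<Longrightarrow>
      left_mult (a, h) (pure_tensor R M N b k) = pure_tensor R M N (a \<otimes>\<^bsub>M\<^esub> b) (h \<otimes>\<^bsub>N\<^esub> k)"
proof -
  have "balanced_map (carrier R) (\<lambda>m r. r \<odot>\<^bsub>M\<^esub> m) (\<lambda>r n. r \<odot>\<^bsub>N\<^esub> n) M N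
      (add_monoid (tensor R M N)) (\<lambda>(b, k). pure_tensor R M N (a \<otimes>\<^bsub>M\<^esub> b) (h \<otimes>\<^bsub>N\<^esub> k))"
    unfolding balanced_map_def
    using a h by (auto simp: M.r_distr N.r_distr pure_add_left pure_add_right
        M.smult_mult_right N.smult_mult_right pure_smult)
  from lift_universal [OF tensor_abelian_group this]
  show "left_mult (a, h) \<in> hom (add_monoid (tensor R M N)) (add_monoid (tensor R M N))"
    and "\<lbrakk>b \<in> carrier M; k \<in> carrier N\<rbrakk> \<Longrightarrow>
      left_mult (a, h) (pure_tensor R M N b k) = pure_tensor R M N (a \<otimes>\<^bsub>M\<^esub> b) (h \<otimes>\<^bsub>N\<^esub> k)"
    by simp_all
qed

lemma left_mult_balanced:
  assumes Y: "Y \<in> carrier (tensor R M N)"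
  shows "balanced_map (carrier R) (\<lambda>m r. r \<odot>\<^bsub>M\<^esub> m) (\<lambda>r n. r \<odot>\<^bsub>N\<^esub> n) M N
    (add_monoid (tensor R M N)) (\<lambda>(a, h). left_mult (a, h) Y)"
proof -
  note ag = tensor_abelian_group and u = left_mult_universal
  have closed: "left_mult (a, h) Y \<in> carrier (tensor R M N)"
    if "a \<in> carrier M" "h \<in> carrier N" for a h
    using hom_in_carrier [OF u(1) [OF that]] Y by simp
  have 1: "left_mult (a \<oplus>\<^bsub>M\<^esub> a', h) Y = left_mult (a, h) Y \<oplus>\<^bsub>tensor R M N\<^esub> left_mult (a', h) Y"
    if c: "a \<in> carrier M" "a' \<in> carrier M" "h \<in> carrier N" for a a' h
    by (rule hom_eqI [OF ag u(1) [OF M.a_closed [OF c(1,2)] c(3)]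
          hom_add_pointwise [OF ag u(1) [OF c(1,3)] u(1) [OF c(2,3)]] _ Y])
       (simp only: u(2) c M.a_closed M.l_distr pure_add_left M.m_closed N.m_closed)
  have 2: "left_mult (a, h \<oplus>\<^bsub>N\<^esub> h') Y = left_mult (a, h) Y \<oplus>\<^bsub>tensor R M N\<^esub> left_mult (a, h') Y"
    if c: "a \<in> carrier M" "h \<in> carrier N" "h' \<in> carrier N" for a h h'
    by (rule hom_eqI [OF ag u(1) [OF c(1) N.a_closed [OF c(2,3)]]
          hom_add_pointwise [OF ag u(1) [OF c(1,2)] u(1) [OF c(1,3)]] _ Y])
       (simp only: u(2) c N.a_closed N.l_distr pure_add_right M.m_closed N.m_closed)
  have 3: "left_mult (r \<odot>\<^bsub>M\<^esub> a, h) Y = left_mult (a, r \<odot>\<^bsub>N\<^esub> h) Y"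
    if c: "a \<in> carrier M" "r \<in> carrier R" "h \<in> carrier N" for a r h
    by (rule hom_eqI [OF ag u(1) [OF M.smult_closed [OF c(2,1)] c(3)]
          u(1) [OF c(1) N.smult_closed [OF c(2,3)]] _ Y])
       (simp only: u(2) c M.smult_closed N.smult_closed M.smult_mult_left N.smult_mult_left
          pure_smult M.m_closed N.m_closed)
  show ?thesis
    unfolding balanced_map_def using closed 1 2 3 by (simp add: Pi_iff)
qed

lemma mult_hom_left:
  "Y \<in> carrier (tensor R M N) \<Longrightarrow>
    (\<lambda>X. X \<otimes>\<^bsub>tensor R M N\<^esub> Y) \<in> hom (add_monoid (tensor R M N)) (add_monoid (tensor R M N))"
  unfolding mult_eq using lift_universal(1) [OF tensor_abelian_group left_mult_balanced] .

lemma mult_pure_left: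
  "\<lbrakk>a \<in> carrier M; h \<in> carrier N; Y \<in> carrier (tensor R M N)\<rbrakk> \<Longrightarrow>
    pure_tensor R M N a h \<otimes>\<^bsub>tensor R M N\<^esub> Y = left_mult (a, h) Y"
  unfolding mult_eq using lift_universal(2) [OF tensor_abelian_group left_mult_balanced] by simp

lemma mult_pure:
  "\<lbrakk>a \<in> carrier M; h \<in> carrier N; b \<in> carrier M; k \<in> carrier N\<rbrakk> \<Longrightarrow>
    pure_tensor R M N a h \<otimes>\<^bsub>tensor R M N\<^esub> pure_tensor R M N b k =
    pure_tensor R M N (a \<otimes>\<^bsub>M\<^esub> b) (h \<otimes>\<^bsub>N\<^esub> k)"
  using left_mult_universal(2) by (simp add: mult_pure_left)

lemma mult_closed:
  "\<lbrakk>X \<in> carrier (tensor R M N); Y \<in> carrier (tensor R M N)\<rbrakk> \<Longrightarrow>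
    X \<otimes>\<^bsub>tensor R M N\<^esub> Y \<in> carrier (tensor R M N)"
  using hom_in_carrier [OF mult_hom_left] by simp

lemma mult_hom_right:
  assumes X: "X \<in> carrier (tensor R M N)"
  shows "(\<lambda>Y. X \<otimes>\<^bsub>tensor R M N\<^esub> Y) \<in> hom (add_monoid (tensor R M N)) (add_monoid (tensor R M N))"
proof -
  interpret T: abelian_group "tensor R M N" by (rule tensor_abelian_group)
  have "X \<otimes>\<^bsub>tensor R M N\<^esub> (Y \<oplus>\<^bsub>tensor R M N\<^esub> Z) =
      (X \<otimes>\<^bsub>tensor R M N\<^esub> Y) \<oplus>\<^bsub>tensor R M N\<^esub> (X \<otimes>\<^bsub>tensor R M N\<^esub> Z)"
    if YZ: "Y \<in> carrier (tensor R M N)" "Z \<in> carrier (tensor R M N)" for Y Z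
  proof (rule hom_eqI [OF tensor_abelian_group mult_hom_left [OF T.a_closed [OF YZ]]
        hom_add_pointwise [OF tensor_abelian_group mult_hom_left [OF YZ(1)]
          mult_hom_left [OF YZ(2)]] _ X])
    fix a h assume ah: "a \<in> carrier M" "h \<in> carrier N"
    show "pure_tensor R M N a h \<otimes>\<^bsub>tensor R M N\<^esub> (Y \<oplus>\<^bsub>tensor R M N\<^esub> Z) =
        (pure_tensor R M N a h \<otimes>\<^bsub>tensor R M N\<^esub> Y) \<oplus>\<^bsub>tensor R M N\<^esub>
        (pure_tensor R M N a h \<otimes>\<^bsub>tensor R M N\<^esub> Z)"
      using hom_mult [OF left_mult_universal(1) [OF ah], of Y Z] ah YZ
      by (simp add: mult_pure_left)
  qed
  then show ?thesis
    using mult_closed [OF X] by (simp add: hom_def Pi_iff)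
qed

end


section \<open>Quotient modules\<close>

text \<open>
  The module axioms are equations, and equations pass to the target of a surjection that respects
  the operations.  This gives the axioms both for quotients and for copies in another type.
\<close>

lemma linear_surjection_module:
  assumes M: "module R M" and f: "linear_map R M N f"
    and surj: "f ` carrier M = carrier N" and zero: "f \<zero>\<^bsub>M\<^esub> = \<zero>\<^bsub>N\<^esub>"
  shows "module R N"
proof -
  interpret M: module R M by fact
  note l = linear_mapD(1) [OF f] linear_mapD(2,3) [OF f, symmetric]
  have ex: "\<exists>x\<in>carrier M. u = f x" if "u \<in> carrier N" for u
    using that surj by blast
  show ?thesis
  proof (rule moduleI)
    show "cring R" by (rule M.R.is_cring)
    show "abelian_group N"
    proof (rule abelian_groupI)
      fix u v assume uv: "u \<in> carrier N" "v \<in> carrier N"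
      show "u \<oplus>\<^bsub>N\<^esub> v \<in> carrier N" and "u \<oplus>\<^bsub>N\<^esub> v = v \<oplus>\<^bsub>N\<^esub> u"
        using ex [OF uv(1)] ex [OF uv(2)] by (auto simp: l M.a_comm)
      fix w assume "w \<in> carrier N"
      then show "u \<oplus>\<^bsub>N\<^esub> v \<oplus>\<^bsub>N\<^esub> w = u \<oplus>\<^bsub>N\<^esub> (v \<oplus>\<^bsub>N\<^esub> w)"
        using ex [OF uv(1)] ex [OF uv(2)] ex [of w] by (auto simp: l M.a_assoc)
    next
      show "\<zero>\<^bsub>N\<^esub> \<in> carrier N" by (simp add: zero [symmetric] l)
    next
      fix u assume u: "u \<in> carrier N"
      show "\<zero>\<^bsub>N\<^esub> \<oplus>\<^bsub>N\<^esub> u = u"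
        using ex [OF u] by (auto simp: l zero [symmetric])
      show "\<exists>v\<in>carrier N. v \<oplus>\<^bsub>N\<^esub> u = \<zero>\<^bsub>N\<^esub>"
      proof -
        obtain x where x: "x \<in> carrier M" "u = f x" using ex [OF u] by blast
        then have "f (\<ominus>\<^bsub>M\<^esub> x) \<oplus>\<^bsub>N\<^esub> u = \<zero>\<^bsub>N\<^esub>"
          by (simp add: l M.l_neg zero)
        then show ?thesis using x l by blast
      qed
    qed
  next
    fix a b x y assume a: "a \<in> carrier R" and b: "b \<in> carrier R"
      and x: "x \<in> carrier N" and y: "y \<in> carrier N"
    show "a \<odot>\<^bsub>N\<^esub> (x \<oplus>\<^bsub>N\<^esub> y) = a \<odot>\<^bsub>N\<^esub> x \<oplus>\<^bsub>N\<^esub> a \<odot>\<^bsub>N\<^esub> y"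
      using ex [OF x] ex [OF y] a by (auto simp: l M.smult_r_distr)
    show "(a \<oplus>\<^bsub>R\<^esub> b) \<odot>\<^bsub>N\<^esub> x = a \<odot>\<^bsub>N\<^esub> x \<oplus>\<^bsub>N\<^esub> b \<odot>\<^bsub>N\<^esub> x"
      "(a \<otimes>\<^bsub>R\<^esub> b) \<odot>\<^bsub>N\<^esub> x = a \<odot>\<^bsub>N\<^esub> (b \<odot>\<^bsub>N\<^esub> x)"
      using ex [OF x] a b by (auto simp: l M.smult_l_distr M.smult_assoc1)
    show "a \<odot>\<^bsub>N\<^esub> x \<in> carrier N"
      using ex [OF x] a by (auto simp: l)
  next
    fix x assume x: "x \<in> carrier N"
    show "\<one>\<^bsub>R\<^esub> \<odot>\<^bsub>N\<^esub> x = x"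
      using ex [OF x] by (auto simp: l)
  qed
qed

text \<open>
  The descended map exists as soon as \<open>f\<close> respects the fibres of \<open>p\<close>; it is computed on a chosen
  preimage, and surjectivity of \<open>p\<close> transfers linearity.
\<close>

lemma descend_linear:
  assumes M: "module R M" and p: "linear_map R M P p" and surj: "p ` carrier M = carrier P"
    and f: "linear_map R M M f"
    and resp: "\<And>x y. \<lbrakk>x \<in> carrier M; y \<in> carrier M; p x = p y\<rbrakk> \<Longrightarrow> p (f x) = p (f y)"
  obtains \<rho> where "linear_map R P P \<rho>" and "\<And>x. x \<in> carrier M \<Longrightarrow> \<rho> (p x) = p (f x)"
proof
  interpret M: module R M by fact
  let ?s = "inv_into (carrier M) p"
  let ?\<rho> = "\<lambda>u. p (f (?s u))"
  note l = linear_mapD [OF p] linear_mapD [OF f]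
  show \<rho>: "?\<rho> (p x) = p (f x)" if x: "x \<in> carrier M" for x
  proof (rule resp [OF _ x])
    have "p x \<in> p ` carrier M" using x by simp
    then show "?s (p x) \<in> carrier M" "p (?s (p x)) = p x"
      by (rule inv_into_into, rule f_inv_into_f)
  qed
  have ex: "\<exists>x\<in>carrier M. u = p x" if "u \<in> carrier P" for u
    using that surj by blast
  show "linear_map R P P ?\<rho>"
    unfolding linear_map_def
  proof (intro conjI funcsetI ballI)
    fix u assume u: "u \<in> carrier P"
    then obtain x where x: "x \<in> carrier M" "u = p x" using ex by blast
    show "?\<rho> u \<in> carrier P" using x by (simp add: \<rho> l)
    show "?\<rho> (u \<oplus>\<^bsub>P\<^esub> v) = ?\<rho> u \<oplus>\<^bsub>P\<^esub> ?\<rho> v" if v: "v \<in> carrier P" for v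
    proof -
      obtain y where y: "y \<in> carrier M" "v = p y" using ex v by blast
      show ?thesis
        using \<rho> [of "x \<oplus>\<^bsub>M\<^esub> y"] x y by (simp add: \<rho> l)
    qed
  next
    fix r u assume r: "r \<in> carrier R" and u: "u \<in> carrier P"
    then obtain x where x: "x \<in> carrier M" "u = p x" using ex by blast
    show "?\<rho> (r \<odot>\<^bsub>P\<^esub> u) = r \<odot>\<^bsub>P\<^esub> ?\<rho> u"
      using \<rho> [of "r \<odot>\<^bsub>M\<^esub> x"] x r by (simp add: \<rho> l)
  qed
qed

locale module_quotient = module R M for R :: "'r ring" and M :: "('r, 'm) module" +
  fixes I :: "'m set"
  assumes submodule: "submodule I R M"
begin

sublocale I: abelian_subgroup I M
  by (rule abelian_subgroupI3)
     (use submodule in \<open>simp_all add: additive_subgroup_def submodule_def M.abelian_group_axioms\<close>)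

abbreviation quot where "quot \<equiv> quotient_module M I"
abbreviation proj where "proj \<equiv> quotient_proj M quot"

lemma quot_simps:
  "carrier quot = a_rcosets\<^bsub>M\<^esub> I" "\<zero>\<^bsub>quot\<^esub> = I" "X \<oplus>\<^bsub>quot\<^esub> Y = X <+>\<^bsub>M\<^esub> Y"
  "r \<odot>\<^bsub>quot\<^esub> X = (\<Union>x\<in>X. I +>\<^bsub>M\<^esub> (r \<odot>\<^bsub>M\<^esub> x))"
  by (simp_all add: quotient_module_def)

lemma proj_eq: "proj x = I +>\<^bsub>M\<^esub> x"
  by (simp add: quotient_proj_def quot_simps)

lemma proj_surj: "proj ` carrier M = carrier quot"
  by (auto simp: proj_eq quot_simps A_RCOSETS_def')

lemma proj_eq_iff:
  assumes "x \<in> carrier M" "y \<in> carrier M"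
  shows "proj x = proj y \<longleftrightarrow> x \<ominus>\<^bsub>M\<^esub> y \<in> I"
proof -
  have "proj x = proj y \<longleftrightarrow> x \<in> I +>\<^bsub>M\<^esub> y"
    unfolding proj_eq
    using I.a_repr_independence' [of x y] I.a_repr_independenceD [of x y] assms by blast
  then show ?thesis
    using I.a_rcos_module [OF assms(2,1)] by (simp add: M.minus_eq)
qed

lemma proj_linear: "linear_map R M quot proj"
proof -
  have smult: "r \<odot>\<^bsub>quot\<^esub> proj x = proj (r \<odot>\<^bsub>M\<^esub> x)" if r: "r \<in> carrier R" and x: "x \<in> carrier M" for r x
  proof -
    have "I +>\<^bsub>M\<^esub> (r \<odot>\<^bsub>M\<^esub> y) = I +>\<^bsub>M\<^esub> (r \<odot>\<^bsub>M\<^esub> x)" if y: "y \<in> I +>\<^bsub>M\<^esub> x" for y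
    proof -
      obtain i where i: "i \<in> I" "y = i \<oplus>\<^bsub>M\<^esub> x"
        using y by (auto simp: a_r_coset_def')
      have ri: "r \<odot>\<^bsub>M\<^esub> i \<in> I"
        using submodule.smult_closed [OF submodule r i(1)] .
      have "r \<odot>\<^bsub>M\<^esub> y = r \<odot>\<^bsub>M\<^esub> i \<oplus>\<^bsub>M\<^esub> r \<odot>\<^bsub>M\<^esub> x"
        using i r x I.a_subset by (auto simp: smult_r_distr)
      then have "r \<odot>\<^bsub>M\<^esub> y \<in> I +>\<^bsub>M\<^esub> (r \<odot>\<^bsub>M\<^esub> x)"
        using ri by (auto simp: a_r_coset_def')
      then show ?thesis
        using I.a_repr_independence' [of _ "r \<odot>\<^bsub>M\<^esub> x"] smult_closed [OF r x] by blast
    qed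
    then have "(\<Union>y\<in>I +>\<^bsub>M\<^esub> x. I +>\<^bsub>M\<^esub> (r \<odot>\<^bsub>M\<^esub> y)) = (\<Union>y\<in>I +>\<^bsub>M\<^esub> x. I +>\<^bsub>M\<^esub> (r \<odot>\<^bsub>M\<^esub> x))"
      by (rule SUP_cong [OF refl])
    then show ?thesis
      using I.a_rcos_self [OF x] unfolding proj_eq quot_simps by blast
  qed
  show ?thesis
    unfolding linear_map_def using proj_surj smult
    by (auto simp: proj_eq quot_simps I.a_rcos_sum)
qed

lemma proj_eq_zero_iff: "x \<in> carrier M \<Longrightarrow> proj x = \<zero>\<^bsub>quot\<^esub> \<longleftrightarrow> x \<in> I"
  unfolding proj_eq quot_simps
  using M.a_coset_join1 I.a_rcos_const I.a_subgroup by blast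

lemma proj_zero: "proj \<zero>\<^bsub>M\<^esub> = \<zero>\<^bsub>quot\<^esub>"
  by (simp add: proj_eq_zero_iff)

lemma quot_module: "module R quot"
  by (rule linear_surjection_module [OF module_axioms proj_linear proj_surj proj_zero])

end


section \<open>Canonical maps of quotients\<close>

context comodule_algebra
begin

sublocale AH: algebra_pair R A H
  by unfold_locales

lemma coaction_closed: "a \<in> carrier A \<Longrightarrow> \<delta> a \<in> carrier (tensor R A H)"
  using coaction_hom by (auto simp: algebra_hom_def linear_map_def)

lemma coaction_add:
  "\<lbrakk>a \<in> carrier A; b \<in> carrier A\<rbrakk> \<Longrightarrow> \<delta> (a \<oplus>\<^bsub>A\<^esub> b) = \<delta> a \<oplus>\<^bsub>tensor R A H\<^esub> \<delta> b"
  using coaction_hom by (auto simp: algebra_hom_def linear_map_def)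

lemma coaction_mult:
  "\<lbrakk>a \<in> carrier A; b \<in> carrier A\<rbrakk> \<Longrightarrow> \<delta> (a \<otimes>\<^bsub>A\<^esub> b) = \<delta> a \<otimes>\<^bsub>tensor R A H\<^esub> \<delta> b"
  using coaction_hom by (auto simp: algebra_hom_def ring_hom_def)

lemma left_mult_linear: "a \<in> carrier A \<Longrightarrow> linear_map R A A (\<lambda>x. a \<otimes>\<^bsub>A\<^esub> x)"
  by (simp add: linear_map_def A.r_distr A.smult_mult_right)

lemma right_mult_linear: "k \<in> carrier H \<Longrightarrow> linear_map R H H (\<lambda>x. x \<otimes>\<^bsub>H\<^esub> k)"
  by (simp add: linear_map_def H.l_distr H.smult_mult_left)

end

text \<open>
  The canonical map of a projection \<open>p: H \<rightarrow> P\<close> is well defined over the coinvariants of \<open>p\<close> because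
  right multiplication by elements of \<open>H\<close> descends to \<open>P\<close>.  Taking this as an axiom covers the identity
  of \<open>H\<close>, the projections \<open>H \<rightarrow> H/I\<close>, and copies of \<open>H/I\<close> in other types, which purity calls for.
\<close>

locale comodule_quotient = comodule_algebra R H \<Delta> \<epsilon> antipode A \<delta> + P: module R P
  for R :: "'r ring" and H :: "('r, 'h) module"
    and \<Delta> :: "'h \<Rightarrow> ('h \<times> 'h \<Rightarrow>\<^sub>0 int) set" and \<epsilon> :: "'h \<Rightarrow> 'r" and antipode :: "'h \<Rightarrow> 'h"
    and A :: "('r, 'a) module" and \<delta> :: "'a \<Rightarrow> ('a \<times> 'h \<Rightarrow>\<^sub>0 int) set"
    and P :: "('r, 'p) module" +
  fixes p :: "'h \<Rightarrow> 'p"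
  assumes p_linear: "linear_map R H P p"
    and p_surj: "p ` carrier H = carrier P"
    and p_mult_right: "\<lbrakk>x \<in> carrier H; y \<in> carrier H; k \<in> carrier H; p x = p y\<rbrakk> \<Longrightarrow>
      p (x \<otimes>\<^bsub>H\<^esub> k) = p (y \<otimes>\<^bsub>H\<^esub> k)"
begin

sublocale AP: module_pair R A P
  by unfold_locales

definition coinv :: "'a set" where
  "coinv = {a \<in> carrier A. tensor_map R A P (\<lambda>x. x) p (\<delta> a) = pure_tensor R A P a (p \<one>\<^bsub>H\<^esub>)}"

text \<open>In Sweedler notation, \<open>push a (\<delta> b)\<close> is \<open>a b\<^sub>0 \<otimes> p(b\<^sub>1)\<close>, the value of the canonical map.\<close>

abbreviation push :: "'a \<Rightarrow> ('a \<times> 'h \<Rightarrow>\<^sub>0 int) set \<Rightarrow> ('a \<times> 'p \<Rightarrow>\<^sub>0 int) set" where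
  "push a \<equiv> tensor_map R A P (\<lambda>x. a \<otimes>\<^bsub>A\<^esub> x) p"

lemmas push_hom = tensor_map_hom(1)
    [OF AH.module_pair_axioms AP.module_pair_axioms left_mult_linear p_linear]
  and push_pure = tensor_map_hom(2)
    [OF AH.module_pair_axioms AP.module_pair_axioms left_mult_linear p_linear]

lemma push_closed:
  "\<lbrakk>a \<in> carrier A; X \<in> carrier (tensor R A H)\<rbrakk> \<Longrightarrow> push a X \<in> carrier (tensor R A P)"
  using hom_in_carrier [OF push_hom] by simp

lemma push_add:
  "\<lbrakk>a \<in> carrier A; X \<in> carrier (tensor R A H); Y \<in> carrier (tensor R A H)\<rbrakk> \<Longrightarrow>
    push a (X \<oplus>\<^bsub>tensor R A H\<^esub> Y) = push a X \<oplus>\<^bsub>tensor R A P\<^esub> push a Y"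
  using hom_mult [OF push_hom, of a X Y] by simp

lemma push_add_left:
  assumes ab: "a \<in> carrier A" "b \<in> carrier A" and X: "X \<in> carrier (tensor R A H)"
  shows "push (a \<oplus>\<^bsub>A\<^esub> b) X = push a X \<oplus>\<^bsub>tensor R A P\<^esub> push b X"
  by (rule AH.hom_eqI [OF AP.tensor_abelian_group push_hom [OF A.a_closed [OF ab]]
        hom_add_pointwise [OF AP.tensor_abelian_group push_hom [OF ab(1)] push_hom [OF ab(2)]] _ X])
     (simp add: push_pure ab A.l_distr AP.pure_add_left linear_mapD [OF p_linear])

text \<open>
  In Sweedler notation this is \<open>a s\<^sub>0 b\<^sub>0 \<otimes> p(s\<^sub>1 b\<^sub>1) = a s b\<^sub>0 \<otimes> p(b\<^sub>1)\<close>: as \<open>p\<close> is compatible with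
  right multiplication, \<open>s\<^sub>0 \<otimes> p(s\<^sub>1) = s \<otimes> p(1)\<close> may be multiplied by \<open>b\<^sub>0 \<otimes> b\<^sub>1\<close> from the right.
\<close>

lemma push_coaction_coinv:
  assumes a: "a \<in> carrier A" and s: "s \<in> coinv" and Y: "Y \<in> carrier (tensor R A H)"
  shows "push a (\<delta> s \<otimes>\<^bsub>tensor R A H\<^esub> Y) = push (a \<otimes>\<^bsub>A\<^esub> s) Y"
proof -
  have sA: "s \<in> carrier A" and s_eq: "tensor_map R A P (\<lambda>x. x) p (\<delta> s) = pure_tensor R A P s (p \<one>\<^bsub>H\<^esub>)"
    using s by (auto simp: coinv_def)
  note AH = AH.module_pair_axioms and AP = AP.module_pair_axioms
  \<comment> \<open>For \<open>Y = b \<otimes> k\<close> the left side depends on \<open>\<delta> s\<close> only through \<open>(A \<otimes> p)(\<delta> s)\<close>, because right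
      multiplication by \<open>k\<close> descends to a map \<open>\<rho>\<close> on \<open>P\<close>.\<close>
  have pure: "push a (\<delta> s \<otimes>\<^bsub>tensor R A H\<^esub> pure_tensor R A H b k) =
      push (a \<otimes>\<^bsub>A\<^esub> s) (pure_tensor R A H b k)"
    if b: "b \<in> carrier A" and k: "k \<in> carrier H" for b k
  proof -
    obtain \<rho> where \<rho>: "linear_map R P P \<rho>"
        and \<rho>_p: "\<And>x. x \<in> carrier H \<Longrightarrow> \<rho> (p x) = p (x \<otimes>\<^bsub>H\<^esub> k)"
      using descend_linear [OF H.module_axioms p_linear p_surj right_mult_linear [OF k]
          p_mult_right [OF _ _ k]] by blast
    have ab: "linear_map R A A (\<lambda>x. a \<otimes>\<^bsub>A\<^esub> (x \<otimes>\<^bsub>A\<^esub> b))"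
      using a b by (simp add: linear_map_def A.l_distr A.r_distr A.smult_mult_left
          A.smult_mult_right)
    note id_p = tensor_map_hom [OF AH AP linear_map_id p_linear]
      and ab_\<rho> = tensor_map_hom [OF AP AP ab \<rho>]
    have "push a (\<delta> s \<otimes>\<^bsub>tensor R A H\<^esub> pure_tensor R A H b k) =
        tensor_map R A P (\<lambda>x. a \<otimes>\<^bsub>A\<^esub> (x \<otimes>\<^bsub>A\<^esub> b)) \<rho> (tensor_map R A P (\<lambda>x. x) p (\<delta> s))"
      by (rule AH.hom_eqI [OF AP.tensor_abelian_group
            hom_compose [OF AH.mult_hom_left [OF AH.pure_closed [OF b k]] push_hom [OF a],
              unfolded comp_def]
            hom_compose [OF id_p(1) ab_\<rho>(1), unfolded comp_def] _ coaction_closed [OF sA]])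
         (simp add: AH.mult_pure push_pure id_p(2) ab_\<rho>(2) a b k \<rho>_p linear_mapD [OF p_linear])
    also have "\<dots> = push (a \<otimes>\<^bsub>A\<^esub> s) (pure_tensor R A H b k)"
      using a b k sA
      by (simp add: s_eq ab_\<rho>(2) push_pure \<rho>_p linear_mapD [OF p_linear] A.m_assoc)
    finally show ?thesis .
  qed
  show ?thesis
    by (rule AH.hom_eqI [OF AP.tensor_abelian_group
          hom_compose [OF AH.mult_hom_right [OF coaction_closed [OF sA]] push_hom [OF a],
            unfolded comp_def]
          push_hom [OF A.m_closed [OF a sA]] pure Y])
qed

lemma can_balanced:
  assumes S: "S \<subseteq> coinv"
  shows "balanced_map S (monoid.mult A) (monoid.mult A) A A (add_monoid (tensor R A P))
    (\<lambda>(a, b). push a (\<delta> b))"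
proof -
  have SA: "S \<subseteq> carrier A" using S by (auto simp: coinv_def)
  have "push (a \<otimes>\<^bsub>A\<^esub> s) (\<delta> b) = push a (\<delta> (s \<otimes>\<^bsub>A\<^esub> b))"
    if "a \<in> carrier A" "s \<in> S" "b \<in> carrier A" for a s b
    using that S SA push_coaction_coinv [of a s "\<delta> b"]
    by (simp add: coaction_mult coaction_closed subset_iff)
  then show ?thesis
    unfolding balanced_map_def
    by (simp add: Pi_iff push_closed push_add push_add_left coaction_closed coaction_add)
qed

lemma can_universal:
  assumes S: "S \<subseteq> coinv"
  shows "can R A \<delta> P p \<in> hom (tensor_over A S) (add_monoid (tensor R A P))"
    and "\<lbrakk>a \<in> carrier A; b \<in> carrier A\<rbrakk> \<Longrightarrow>
      can R A \<delta> P p (tensor_elem S (monoid.mult A) (monoid.mult A) A A a b) = push a (\<delta> b)"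
proof -
  have SA: "S \<subseteq> carrier A" using S by (auto simp: coinv_def)
  note u = tensor_lift_universal [OF abelian_group.a_comm_group [OF AP.tensor_abelian_group]
      can_balanced [OF S] _ _ A.abelian_group_axioms A.abelian_group_axioms]
  show "can R A \<delta> P p \<in> hom (tensor_over A S) (add_monoid (tensor R A P))"
    unfolding can_def tensor_over_def by (rule u(1)) (use SA in auto)
  show "can R A \<delta> P p (tensor_elem S (monoid.mult A) (monoid.mult A) A A a b) = push a (\<delta> b)"
    if "a \<in> carrier A" "b \<in> carrier A"
    unfolding can_def by (subst u(2)) (use SA that in auto)
qed

end

context comodule_algebra
begin

lemma id_quotient: "comodule_quotient R H \<Delta> \<epsilon> antipode A \<delta> H (\<lambda>h. h)"
  by unfold_locales (simp_all add: linear_map_id)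

lemma coinvariants_H_eq_coinv:
  "coinvariants_H R H A \<delta> = comodule_quotient.coinv R H A \<delta> H (\<lambda>h. h)"
  unfolding coinvariants_H_def comodule_quotient.coinv_def [OF id_quotient]
proof (rule Collect_cong, rule conj_cong [OF refl])
  fix a assume "a \<in> carrier A"
  then show "\<delta> a = pure_tensor R A H a \<one>\<^bsub>H\<^esub> \<longleftrightarrow>
      tensor_map R A H (\<lambda>x. x) (\<lambda>h. h) (\<delta> a) = pure_tensor R A H a \<one>\<^bsub>H\<^esub>"
    by (subst tensor_map_id [OF AH.module_pair_axioms coaction_closed]) simp_all
qed

lemma coinvariants_eq_coinv:
  assumes "comodule_quotient R H \<Delta> \<epsilon> antipode A \<delta> Q (quotient_proj H Q)"
  shows "coinvariants R H A \<delta> Q = comodule_quotient.coinv R H A \<delta> Q (quotient_proj H Q)"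
  unfolding coinvariants_def comodule_quotient.coinv_def [OF assms] ..

text \<open>
  The square formed by \<open>can_H\<close>, \<open>can\<close> for \<open>p\<close>, the projection \<open>A \<otimes>\<^sub>B A \<rightarrow> A \<otimes>\<^sub>S A\<close> and \<open>A \<otimes> p\<close>
  commutes.  The projection does not depend on \<open>p\<close>, and hence it can be shared by two quotients
  with the same coinvariants.
\<close>

definition restrict_base :: "'a set \<Rightarrow> ('a \<times> 'a \<Rightarrow>\<^sub>0 int) set \<Rightarrow> ('a \<times> 'a \<Rightarrow>\<^sub>0 int) set" where
  "restrict_base S = tensor_lift (tensor_over A S)
     (\<lambda>(a, b). tensor_elem S (monoid.mult A) (monoid.mult A) A A a b)"

lemma restrict_base_universal:
  assumes "B \<subseteq> S" and "S \<subseteq> carrier A"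
  shows "restrict_base S \<in> hom (tensor_over A B) (tensor_over A S)"
    and "\<lbrakk>a \<in> carrier A; b \<in> carrier A\<rbrakk> \<Longrightarrow>
      restrict_base S (tensor_elem B (monoid.mult A) (monoid.mult A) A A a b) =
      tensor_elem S (monoid.mult A) (monoid.mult A) A A a b"
proof -
  interpret S: tensor_factors S "monoid.mult A" "monoid.mult A" A A
    using assms(2) by unfold_locales auto
  have "balanced_map B (monoid.mult A) (monoid.mult A) A A S.T (\<lambda>(a, b). S.elem a b)"
    using S.balanced_elem assms(1) unfolding balanced_map_def by blast
  note u = tensor_lift_universal [OF S.tensor_comm_group this _ _
      A.abelian_group_axioms A.abelian_group_axioms]
  show "restrict_base S \<in> hom (tensor_over A B) (tensor_over A S)"
    unfolding restrict_base_def tensor_over_def by (rule u(1)) (use assms in auto)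
  show "restrict_base S (tensor_elem B (monoid.mult A) (monoid.mult A) A A a b) = S.elem a b"
    if "a \<in> carrier A" "b \<in> carrier A"
    unfolding restrict_base_def tensor_over_def by (subst u(2)) (use assms that in auto)
qed

lemma can_restrict_base:
  assumes "comodule_quotient R H \<Delta> \<epsilon> antipode A \<delta> P p"
    and B: "B = coinvariants_H R H A \<delta>" and BS: "B \<subseteq> S"
    and S: "S \<subseteq> comodule_quotient.coinv R H A \<delta> P p"
    and X: "X \<in> carrier (tensor_over A B)"
  shows "can R A \<delta> P p (restrict_base S X) = tensor_map R A P (\<lambda>x. x) p (can_H R H A \<delta> X)"
proof -
  interpret P: comodule_quotient R H \<Delta> \<epsilon> antipode A \<delta> P p by fact
  interpret I: comodule_quotient R H \<Delta> \<epsilon> antipode A \<delta> H "\<lambda>h. h" by (rule id_quotient)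
  have SA: "S \<subseteq> carrier A" using S by (auto simp: P.coinv_def)
  have BI: "B \<subseteq> I.coinv" using B coinvariants_H_eq_coinv by simp
  interpret B: tensor_factors B "monoid.mult A" "monoid.mult A" A A
    using BS SA by unfold_locales auto
  note q = restrict_base_universal [OF BS SA] and cP = P.can_universal [OF S]
    and cI = I.can_universal [OF BI]
  note AH = AH.module_pair_axioms and AP = P.AP.module_pair_axioms
  note idp = tensor_map_hom [OF AH AP linear_map_id P.p_linear]
  show ?thesis
    unfolding can_H_def
  proof (rule B.tensor_hom_eqI [OF abelian_group.a_group [OF P.AP.tensor_abelian_group]
        hom_compose [OF q(1) cP(1), unfolded comp_def tensor_over_def]
        hom_compose [OF cI(1) idp(1), unfolded comp_def tensor_over_def] _
        X [unfolded tensor_over_def]])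
    fix a b assume ab: "a \<in> carrier A" "b \<in> carrier A"
    show "can R A \<delta> P p (restrict_base S (B.elem a b)) =
        tensor_map R A P (\<lambda>x. x) p (can R A \<delta> H (\<lambda>h. h) (B.elem a b))"
      using tensor_map_comp [OF AH AH AP left_mult_linear [OF ab(1)] linear_map_id linear_map_id
          P.p_linear coaction_closed [OF ab(2)]]
      by (simp add: q(2) cP(2) cI(2) ab)
  qed
qed

end

text \<open>
  The heart of the argument.  If \<open>1 \<otimes> h = can_H X\<close>, then the projection of \<open>X\<close> to \<open>A \<otimes>\<^sub>S A\<close> is sent
  to \<open>1 \<otimes> q(h)\<close> by the canonical map of \<open>q\<close> and to \<open>1 \<otimes> p(h)\<close> by that of \<open>p\<close>.  When the former map
  is injective, the kernel of \<open>q\<close> is therefore contained in the kernel of \<open>1 \<otimes> p\<close>.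
\<close>

lemma (in comodule_algebra) pure_eq_zero_of_can_inj:
  assumes Q: "comodule_quotient R H \<Delta> \<epsilon> antipode A \<delta> Q q"
    and P: "comodule_quotient R H \<Delta> \<epsilon> antipode A \<delta> P p"
    and B: "B = coinvariants_H R H A \<delta>" and BS: "B \<subseteq> S"
    and surj: "can_H R H A \<delta> ` carrier (tensor_over A B) = carrier (tensor R A H)"
    and SQ: "S \<subseteq> comodule_quotient.coinv R H A \<delta> Q q"
    and SP: "S \<subseteq> comodule_quotient.coinv R H A \<delta> P p"
    and inj: "inj_on (can R A \<delta> Q q) (carrier (tensor_over A S))"
    and h: "h \<in> carrier H" and qh: "q h = \<zero>\<^bsub>Q\<^esub>"
  shows "pure_tensor R A P \<one>\<^bsub>A\<^esub> (p h) = \<zero>\<^bsub>tensor R A P\<^esub>"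
proof -
  interpret Q: comodule_quotient R H \<Delta> \<epsilon> antipode A \<delta> Q q by fact
  interpret P: comodule_quotient R H \<Delta> \<epsilon> antipode A \<delta> P p by fact
  have SA: "S \<subseteq> carrier A" using SP by (auto simp: P.coinv_def)
  note AH = AH.module_pair_axioms
  note idP = tensor_map_hom(2) [OF AH P.AP.module_pair_axioms linear_map_id P.p_linear]
    and idQ = tensor_map_hom(2) [OF AH Q.AP.module_pair_axioms linear_map_id Q.p_linear]
  have "pure_tensor R A H \<one>\<^bsub>A\<^esub> h \<in> carrier (tensor R A H)" using h by simp
  then obtain X where X: "X \<in> carrier (tensor_over A B)"
      and canX: "can_H R H A \<delta> X = pure_tensor R A H \<one>\<^bsub>A\<^esub> h"
    using surj by (metis imageE)
  let ?Y = "restrict_base S X"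
  interpret S: tensor_factors S "monoid.mult A" "monoid.mult A" A A
    using SA by unfold_locales auto
  have S_group: "group (tensor_over A S)"
    unfolding tensor_over_def using S.tensor_comm_group by (rule comm_group.axioms(2))
  have Y: "?Y \<in> carrier (tensor_over A S)"
    using hom_in_carrier [OF restrict_base_universal(1) [OF BS SA] X] .
  have "can R A \<delta> Q q ?Y = \<zero>\<^bsub>tensor R A Q\<^esub>"
    using can_restrict_base [OF Q B BS SQ X] h
    by (simp add: canX idQ qh Q.AP.pure_zero_right)
  also have "\<dots> = can R A \<delta> Q q \<one>\<^bsub>tensor_over A S\<^esub>"
    using hom_one [OF Q.can_universal(1) [OF SQ] S_group
        abelian_group.a_group [OF Q.AP.tensor_abelian_group]] by simp
  finally have "?Y = \<one>\<^bsub>tensor_over A S\<^esub>"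
    using inj Y group.is_monoid [OF S_group] by (auto simp: inj_on_def)
  then have "can R A \<delta> P p ?Y = \<zero>\<^bsub>tensor R A P\<^esub>"
    using hom_one [OF P.can_universal(1) [OF SP] S_group
        abelian_group.a_group [OF P.AP.tensor_abelian_group]] by simp
  then show ?thesis
    using can_restrict_base [OF P B BS SP X] h by (simp add: canX idP)
qed


section \<open>Purity\<close>

lemma regular_module:
  assumes "cring R" shows "module R (regular_module R)"
proof -
  interpret cring R by fact
  show ?thesis
  proof (rule moduleI)
    show "abelian_group (regular_module R)"
      by (rule abelian_groupI)
         (auto simp: regular_module_def a_ac intro: add.l_inv_ex)
  qed (auto simp: regular_module_def l_distr r_distr m_assoc assms)
qed

lemma regular_tensor_pure_one_eq_zero:
  fixes R :: "'r ring" and M :: "('r, 'm) module"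
  assumes "module R M" and x: "x \<in> carrier M"
    and zero: "pure_tensor R (regular_module R) M \<one>\<^bsub>R\<^esub> x = \<zero>\<^bsub>tensor R (regular_module R) M\<^esub>"
  shows "x = \<zero>\<^bsub>M\<^esub>"
proof -
  interpret module R M by fact
  let ?f = "\<lambda>(r, y). r \<odot>\<^bsub>M\<^esub> y"
  interpret RM: module_pair R "regular_module R" M
    using regular_module [OF R.is_cring] module_axioms by (rule module_pair.intro)
  have "balanced_map (carrier R) (\<lambda>m r. r \<odot>\<^bsub>regular_module R\<^esub> m) (\<lambda>r n. r \<odot>\<^bsub>M\<^esub> n)
      (regular_module R) M (add_monoid M) ?f"
    unfolding balanced_map_def
    by (auto simp: regular_module_def smult_l_distr smult_r_distr R.m_comm
        simp flip: smult_assoc1)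
  note u = RM.lift_universal(2) [OF M.abelian_group_axioms this]
  have one: "\<one>\<^bsub>R\<^esub> \<in> carrier (regular_module R)" by (simp add: regular_module_def)
  show ?thesis
    using u [OF one x] u [OF one M.zero_closed] x zero RM.pure_zero_right [OF one] by simp
qed

text \<open>
  Purity enters the proof in this form: \<open>P \<rightarrow> A \<otimes> P\<close>, \<open>x \<mapsto> 1 \<otimes> x\<close>, is
  injective, being the composite of \<open>P \<cong> R \<otimes> P\<close> with the unit tensored with \<open>P\<close>.
\<close>

lemma (in assoc_algebra) pure_one_eq_zero:
  fixes P :: "('r, 'p) module"
  assumes pure: "pure_mono TYPE('p) R (regular_module R) A (algebra_unit A)"
    and P: "module R P" and x: "x \<in> carrier P"
    and zero: "pure_tensor R A P \<one>\<^bsub>A\<^esub> x = \<zero>\<^bsub>tensor R A P\<^esub>"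
  shows "x = \<zero>\<^bsub>P\<^esub>"
proof (rule regular_tensor_pure_one_eq_zero [OF P x])
  interpret P: module R P by fact
  interpret RP: module_pair R "regular_module R" P
    using regular_module [OF R.is_cring] P by (rule module_pair.intro)
  interpret AP: module_pair R A P
    by unfold_locales
  interpret AP: abelian_group "tensor R A P" by (rule AP.tensor_abelian_group)
  interpret RPt: abelian_group "tensor R (regular_module R) P" by (rule RP.tensor_abelian_group)
  let ?f = "tensor_map R A P (algebra_unit A) (\<lambda>x. x)"
  have unit: "linear_map R (regular_module R) A (algebra_unit A)"
    and inj: "inj_on ?f (carrier (tensor R (regular_module R) P))"
    using pure P by (auto simp: pure_mono_def)
  note f = tensor_map_hom [OF RP.module_pair_axioms AP.module_pair_axioms unit linear_map_id]
  have one: "\<one>\<^bsub>R\<^esub> \<in> carrier (regular_module R)" by (simp add: regular_module_def)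
  have "?f (pure_tensor R (regular_module R) P \<one>\<^bsub>R\<^esub> x) = \<zero>\<^bsub>tensor R A P\<^esub>"
    using f(2) [OF one x] zero by (simp add: algebra_unit_def)
  also have "\<dots> = ?f \<zero>\<^bsub>tensor R (regular_module R) P\<^esub>"
    using hom_one [OF f(1) RPt.a_group AP.a_group] by simp
  finally show "pure_tensor R (regular_module R) P \<one>\<^bsub>R\<^esub> x = \<zero>\<^bsub>tensor R (regular_module R) P\<^esub>"
    using inj RP.pure_closed [OF one x] by (auto simp: inj_on_def)
qed

text \<open>
  Purity is assumed for the modules of a single type only; a module of another type is replaced by
  its image under an injection \<open>\<iota>\<close>.
\<close>

definition copy_module :: "('m \<Rightarrow> 'n) \<Rightarrow> ('r, 'm) module \<Rightarrow> ('r, 'n) module" where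
  "copy_module \<iota> M =
    \<lparr>carrier = \<iota> ` carrier M, monoid.mult = undefined, one = undefined, zero = \<iota> \<zero>\<^bsub>M\<^esub>,
     add = (\<lambda>u v. \<iota> (the_inv_into (carrier M) \<iota> u \<oplus>\<^bsub>M\<^esub> the_inv_into (carrier M) \<iota> v)),
     smult = (\<lambda>r u. \<iota> (r \<odot>\<^bsub>M\<^esub> the_inv_into (carrier M) \<iota> u))\<rparr>"

lemma copy_linear:
  assumes "inj_on \<iota> (carrier M)"
  shows "linear_map R M (copy_module \<iota> M) \<iota>"
  using assms by (simp add: linear_map_def copy_module_def the_inv_into_f_f)

lemma copy_module:
  fixes R :: "'r ring"
  assumes "module R M" and "inj_on \<iota> (carrier M)"
  shows "module R (copy_module \<iota> M)"
  by (rule linear_surjection_module [OF assms(1) copy_linear [OF assms(2)]])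
     (simp_all add: copy_module_def)

context comodule_quotient
begin

lemma copy_quotient:
  assumes inj: "inj_on \<iota> (carrier P)"
  shows "comodule_quotient R H \<Delta> \<epsilon> antipode A \<delta> (copy_module \<iota> P) (\<lambda>h. \<iota> (p h))"
proof (intro comodule_quotient.intro comodule_quotient_axioms.intro)
  show "comodule_algebra R H \<Delta> \<epsilon> antipode A \<delta>" ..
  show "module R (copy_module \<iota> P)" by (rule copy_module [OF P.module_axioms inj])
  show "linear_map R H (copy_module \<iota> P) (\<lambda>h. \<iota> (p h))"
    by (rule linear_map_comp [OF p_linear copy_linear [OF inj]])
  show "(\<lambda>h. \<iota> (p h)) ` carrier H = carrier (copy_module \<iota> P)"
    using p_surj by (simp add: copy_module_def image_image [symmetric])
next
  fix x y k
  assume "x \<in> carrier H" "y \<in> carrier H" and k: "k \<in> carrier H" and "\<iota> (p x) = \<iota> (p y)"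
  then have "x \<in> carrier H" "y \<in> carrier H" "p x = p y"
    using inj linear_mapD(1) [OF p_linear] by (auto dest: inj_onD)
  then show "\<iota> (p (x \<otimes>\<^bsub>H\<^esub> k)) = \<iota> (p (y \<otimes>\<^bsub>H\<^esub> k))"
    using p_mult_right k by metis
qed

lemma coinv_subset_copy:
  assumes inj: "inj_on \<iota> (carrier P)"
  shows "coinv \<subseteq> comodule_quotient.coinv R H A \<delta> (copy_module \<iota> P) (\<lambda>h. \<iota> (p h))"
proof
  interpret C: comodule_quotient R H \<Delta> \<epsilon> antipode A \<delta> "copy_module \<iota> P" "\<lambda>h. \<iota> (p h)"
    by (rule copy_quotient [OF inj])
  note AC = C.AP.module_pair_axioms and \<iota> = copy_linear [OF inj]
  fix a assume "a \<in> coinv"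
  then have a: "a \<in> carrier A"
    and eq: "tensor_map R A P (\<lambda>x. x) p (\<delta> a) = pure_tensor R A P a (p \<one>\<^bsub>H\<^esub>)"
    by (auto simp: coinv_def)
  have "tensor_map R A (copy_module \<iota> P) (\<lambda>x. x) (\<lambda>h. \<iota> (p h)) (\<delta> a) =
      tensor_map R A (copy_module \<iota> P) (\<lambda>x. x) \<iota> (tensor_map R A P (\<lambda>x. x) p (\<delta> a))"
    using tensor_map_comp [OF AH.module_pair_axioms AP.module_pair_axioms AC linear_map_id p_linear
        linear_map_id \<iota> coaction_closed [OF a]] by simp
  also have "\<dots> = pure_tensor R A (copy_module \<iota> P) a (\<iota> (p \<one>\<^bsub>H\<^esub>))"
    unfolding eq
    by (rule tensor_map_hom(2) [OF AP.module_pair_axioms AC linear_map_id \<iota> a])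
       (simp add: linear_mapD [OF p_linear])
  finally show "a \<in> C.coinv" using a by (simp add: C.coinv_def)
qed

end


section \<open>Closed elements\<close>

lemma (in comodule_algebra) right_ideal_coideal_quotient:
  assumes I: "right_ideal_coideal R H \<Delta> \<epsilon> I"
  shows "module_quotient R H I"
    and "comodule_quotient R H \<Delta> \<epsilon> antipode A \<delta> (quotient_module H I)
      (quotient_proj H (quotient_module H I))"
proof -
  have sub: "submodule I R H" and ideal: "\<And>x k. \<lbrakk>x \<in> I; k \<in> carrier H\<rbrakk> \<Longrightarrow> x \<otimes>\<^bsub>H\<^esub> k \<in> I"
    using I by (auto simp: right_ideal_coideal_def)
  show mq: "module_quotient R H I"
    by (intro module_quotient.intro module_quotient_axioms.intro H.module_axioms sub)
  interpret module_quotient R H I by (rule mq)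
  show "comodule_quotient R H \<Delta> \<epsilon> antipode A \<delta> (quotient_module H I)
      (quotient_proj H (quotient_module H I))"
  proof (intro comodule_quotient.intro comodule_quotient_axioms.intro)
    show "comodule_algebra R H \<Delta> \<epsilon> antipode A \<delta>" ..
    fix x y k
    assume xyk: "x \<in> carrier H" "y \<in> carrier H" "k \<in> carrier H" and eq: "proj x = proj y"
    have "(x \<ominus>\<^bsub>H\<^esub> y) \<otimes>\<^bsub>H\<^esub> k = x \<otimes>\<^bsub>H\<^esub> k \<ominus>\<^bsub>H\<^esub> y \<otimes>\<^bsub>H\<^esub> k"
      using xyk by (simp add: H.minus_eq H.l_distr H.l_minus)
    then show "proj (x \<otimes>\<^bsub>H\<^esub> k) = proj (y \<otimes>\<^bsub>H\<^esub> k)"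
      using ideal [of "x \<ominus>\<^bsub>H\<^esub> y" k] xyk eq by (simp add: proj_eq_iff)
  qed (rule quot_module proj_linear proj_surj)+
qed

text \<open>
  The canonical map of \<open>H/I\<close> is bijective on \<open>A \<otimes>\<^sub>S A\<close>, and \<open>S\<close> consists of coinvariants of \<open>H/J\<close> too.
  So \<open>1 \<otimes> h\<close> vanishes in \<open>A \<otimes> H/J\<close> for \<open>h \<in> I\<close>, and purity removes the factor \<open>1\<close>.  Purity is
  applied to the copy of \<open>H/J\<close> under \<open>Inl\<close>, which lives in the type that \<open>pure_mono\<close> speaks of.
\<close>

lemma (in comodule_algebra) coideal_le_of_Q_Galois:
  fixes I J :: "'h set"
  assumes pure: "pure_mono TYPE('h set + 'c) R (regular_module R) A (algebra_unit A)"
    and I: "right_ideal_coideal R H \<Delta> \<epsilon> I" and J: "right_ideal_coideal R H \<Delta> \<epsilon> J"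
    and surj: "can_H R H A \<delta> ` carrier (tensor_over A (coinvariants_H R H A \<delta>)) =
      carrier (tensor R A H)"
    and base: "coinvariants_H R H A \<delta> \<subseteq> coinvariants R H A \<delta> (quotient_module H I)"
    and sub: "coinvariants R H A \<delta> (quotient_module H I) \<subseteq>
      coinvariants R H A \<delta> (quotient_module H J)"
    and Gal: "Q_Galois R H A \<delta> (quotient_module H I)"
  shows "I \<subseteq> J"
proof
  let ?S = "coinvariants R H A \<delta> (quotient_module H I)"
  let ?\<iota> = "Inl :: 'h set \<Rightarrow> 'h set + 'c"
  let ?P = "copy_module ?\<iota> (quotient_module H J)"
  interpret QI: module_quotient R H I by (rule right_ideal_coideal_quotient(1) [OF I])
  interpret QJ: module_quotient R H J by (rule right_ideal_coideal_quotient(1) [OF J])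
  note cI = right_ideal_coideal_quotient(2) [OF I] and cJ = right_ideal_coideal_quotient(2) [OF J]
  interpret CJ: comodule_quotient R H \<Delta> \<epsilon> antipode A \<delta> QJ.quot QJ.proj by (rule cJ)
  have inj: "inj_on ?\<iota> (carrier QJ.quot)" by simp
  note cP = CJ.copy_quotient [OF inj]
  have SP: "?S \<subseteq> comodule_quotient.coinv R H A \<delta> ?P (\<lambda>h. ?\<iota> (QJ.proj h))"
    using sub CJ.coinv_subset_copy [OF inj] coinvariants_eq_coinv [OF cJ] by simp
  fix h assume hI: "h \<in> I"
  then have h: "h \<in> carrier H" using QI.I.a_subset by blast
  have "pure_tensor R A ?P \<one>\<^bsub>A\<^esub> (?\<iota> (QJ.proj h)) = \<zero>\<^bsub>tensor R A ?P\<^esub>"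
  proof (rule pure_eq_zero_of_can_inj [OF cI cP refl base surj _ SP _ h])
    show "?S \<subseteq> comodule_quotient.coinv R H A \<delta> QI.quot QI.proj"
      using coinvariants_eq_coinv [OF cI] by simp
    show "inj_on (can R A \<delta> QI.quot QI.proj) (carrier (tensor_over A ?S))"
      using Gal by (simp add: Q_Galois_def can_Q_def bij_betw_def)
    show "QI.proj h = \<zero>\<^bsub>QI.quot\<^esub>"
      using hI h by (simp add: QI.proj_eq_zero_iff)
  qed
  moreover have "?\<iota> (QJ.proj h) \<in> carrier ?P"
    using h QJ.proj_surj by (auto simp: copy_module_def)
  ultimately have "?\<iota> (QJ.proj h) = \<zero>\<^bsub>?P\<^esub>"
    using A.pure_one_eq_zero [OF pure copy_module [OF QJ.quot_module inj]] by blast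
  then show "h \<in> J"
    using h by (simp add: copy_module_def QJ.proj_eq_zero_iff)
qed

theorem corollary4p3p4:
  fixes R :: "'r ring" and H :: "('r, 'h) module" and A :: "('r, 'a) module"
    and \<Delta> :: "'h \<Rightarrow> ('h \<times> 'h \<Rightarrow>\<^sub>0 int) set" and \<epsilon> :: "'h \<Rightarrow> 'r" and antipode :: "'h \<Rightarrow> 'h"
    and \<delta> :: "'a \<Rightarrow> ('a \<times> 'h \<Rightarrow>\<^sub>0 int) set"
    and B :: "'a set" and \<psi> :: "'a set \<Rightarrow> ('r, 'h set) module" and Q :: "('r, 'h set) module"
  assumes "hopf_algebra R H \<Delta> \<epsilon> antipode"
    and "comodule_algebra R H \<Delta> \<epsilon> antipode A \<delta>"
    and "B = coinvariants_H R H A \<delta>"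
    and "can_H R H A \<delta> ` carrier (tensor_over A B) = carrier (tensor R A H)"
    and "antitone_galois_connection (Sub_Alg R A B) (Quot_gen R H \<Delta> \<epsilon>) (coinvariants R H A \<delta>) \<psi>"
    and "pure_mono TYPE('h set + (nat \<Rightarrow> 'r) set) R (regular_module R) A (algebra_unit A)"
    and "Q \<in> carrier (Quot_gen R H \<Delta> \<epsilon>)"
    and "Q_Galois R H A \<delta> Q"
  shows "closed_element (coinvariants R H A \<delta>) \<psi> Q"
proof -
  interpret comodule_algebra R H \<Delta> \<epsilon> antipode A \<delta> by fact
  let ?\<phi> = "coinvariants R H A \<delta>" and ?X = "Sub_Alg R A B" and ?Y = "Quot_gen R H \<Delta> \<epsilon>"
  note Gal = assms(5) [unfolded antitone_galois_connection_def]
  have S: "?\<phi> Q \<in> carrier ?X"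
    using Gal assms(7) by blast
  then have Q': "\<psi> (?\<phi> Q) \<in> carrier ?Y"
    using Gal by blast
  have le: "Q \<sqsubseteq>\<^bsub>?Y\<^esub> \<psi> (?\<phi> Q)" and sub: "?\<phi> Q \<sqsubseteq>\<^bsub>?X\<^esub> ?\<phi> (\<psi> (?\<phi> Q))"
    using Gal assms(7) S by blast+
  obtain I where I: "right_ideal_coideal R H \<Delta> \<epsilon> I" "Q = quotient_module H I"
    using assms(7) by (auto simp: Quot_gen_def)
  obtain J where J: "right_ideal_coideal R H \<Delta> \<epsilon> J" "\<psi> (?\<phi> Q) = quotient_module H J"
    using Q' by (auto simp: Quot_gen_def)
  have quot_inj: "K = L" if "quotient_module H K = quotient_module H L" for K L
    using arg_cong [OF that, of zero] by (simp add: quotient_module_def)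
  have "J \<subseteq> I"
  proof -
    obtain I' J' where "Q = quotient_module H I'" "\<psi> (?\<phi> Q) = quotient_module H J'" "J' \<subseteq> I'"
      using le by (auto simp: Quot_gen_def)
    then show ?thesis
      using quot_inj [of I I'] quot_inj [of J J'] I(2) J(2) by simp
  qed
  moreover have "I \<subseteq> J"
  proof (rule coideal_le_of_Q_Galois [OF assms(6) I(1) J(1)])
    show "can_H R H A \<delta> ` carrier (tensor_over A (coinvariants_H R H A \<delta>)) =
        carrier (tensor R A H)"
      using assms(3,4) by simp
    show "coinvariants_H R H A \<delta> \<subseteq> ?\<phi> (quotient_module H I)"
      using S assms(3) I(2) by (simp add: Sub_Alg_def)
    show "?\<phi> (quotient_module H I) \<subseteq> ?\<phi> (quotient_module H J)"
      using sub I(2) J(2) by (simp add: Sub_Alg_def)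
    show "Q_Galois R H A \<delta> (quotient_module H I)"
      using assms(8) I(2) by simp
  qed
  ultimately show ?thesis
    unfolding closed_element_def using I(2) J(2) by simp
qed

end
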